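(* Let $1\leq p<2$ and let $\psi:\mathbb{D}\to\mathbb{D}$ be analytic and univalent. Let $C_\psi(f)=f\circ\psi$. Then: (1) the composition operator $C_\psi: BMOA_p\to BMOA_p$ is bounded, and $$\|C_\psi\|_{BMOA_p\to BMOA_p}\leq C\left(1+\log\frac{1+|\psi(0)|}{1-|\psi(0)|}\right),$$ where $C$ is a constant depending only on $p$; (2) $C_\psi: VMOA_p\to VMOA_p$ is also bounded.
   Context: $\mathbb{D}$ is the open unit disc in $\mathbb{C}$, $H(\mathbb{D})$ the space of analytic functions on $\mathbb{D}$, $dm$ the normalized Lebesgue area measure on $\mathbb{D}$ ($dm=r\,dr\,d\theta/\pi$), and $\varphi_a(z)=\frac{a-z}{1-\bar a z}$ for $a\in\mathbb{D}$. For $p\geq 1$, $BMOA_p$ is the Banach space of $f\in H(\mathbb{D})$ with finite norm $$\|f\|_{BMOA_p}^p=|f(0)|^p+\sup_{a\in\mathbb{D}}\int_{\mathbb{D}}|f'(z)|^p(1-|z|^2)^{p-2}(1-|\varphi_a(z)|^2)\,dm(z).$$ $VMOA_p$ is the closed subspace, with the same norm, of those $f\in BMOA_p$ for which $\lim_{|a|\to1}\int_{\mathbb{D}}|f'(z)|^p(1-|z|^2)^{p-2}(1-|\varphi_a(z)|^2)\,dm(z)=0$. Univalent means injective. *)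

theory Defs
  imports "HOL-Complex_Analysis.Complex_Analysis"
begin

abbreviation unit_disc :: "complex set" where
  "unit_disc \<equiv> ball 0 1"

definition disc_measure :: "complex measure" where
  "disc_measure = scale_measure (ennreal (1 / pi)) (restrict_space lborel unit_disc)"

definition disc_aut :: "complex \<Rightarrow> complex \<Rightarrow> complex" where
  "disc_aut a z = (a - z) / (1 - cnj a * z)"

text \<open>
  The integral is taken in \<^typ>\<open>ennreal\<close>, so that divergence is the value \<open>\<infinity>\<close>.
\<close>

definition bmoa_integral :: "real \<Rightarrow> (complex \<Rightarrow> complex) \<Rightarrow> complex \<Rightarrow> ennreal" where
  "bmoa_integral p f a =
     (\<integral>\<^sup>+ z. ennreal (norm (deriv f z) powr p * (1 - (norm z)\<^sup>2) powr (p - 2)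
                    * (1 - (norm (disc_aut a z))\<^sup>2)) \<partial>disc_measure)"

definition bmoa_sup :: "real \<Rightarrow> (complex \<Rightarrow> complex) \<Rightarrow> ennreal" where
  "bmoa_sup p f = (SUP a \<in> unit_disc. bmoa_integral p f a)"

text \<open>
  Functions on the disc are total functions whose values outside the disc are irrelevant:
  neither membership in the two spaces nor the norm depends on them.
\<close>

definition BMOA :: "real \<Rightarrow> (complex \<Rightarrow> complex) set" where
  "BMOA p = {f. f holomorphic_on unit_disc \<and> bmoa_sup p f < \<infinity>}"

text \<open>Meaningful only on \<^term>\<open>BMOA p\<close>, since \<^const>\<open>enn2real\<close> sends \<open>\<infinity>\<close> to \<open>0\<close>.\<close>

definition bmoa_norm :: "real \<Rightarrow> (complex \<Rightarrow> complex) \<Rightarrow> real" where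
  "bmoa_norm p f = (norm (f 0) powr p + enn2real (bmoa_sup p f)) powr (1 / p)"

text \<open>The filter expresses that \<open>a\<close> lies in the disc and its modulus tends to \<open>1\<close>.\<close>

definition VMOA :: "real \<Rightarrow> (complex \<Rightarrow> complex) set" where
  "VMOA p = {f \<in> BMOA p. (bmoa_integral p f \<longlongrightarrow> 0) (filtercomap norm (at_left 1))}"

definition composition_operator ::
    "(complex \<Rightarrow> complex) \<Rightarrow> (complex \<Rightarrow> complex) \<Rightarrow> complex \<Rightarrow> complex" where
  "composition_operator \<psi> f = f \<circ> \<psi>"

definition bounded_operator ::
    "(complex \<Rightarrow> complex) set \<Rightarrow> (complex \<Rightarrow> complex) set \<Rightarrow> ((complex \<Rightarrow> complex) \<Rightarrow> real)
      \<Rightarrow> ((complex \<Rightarrow> complex) \<Rightarrow> complex \<Rightarrow> complex) \<Rightarrow> bool" where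
  "bounded_operator X Y N T \<longleftrightarrow>
     (\<forall>f\<in>X. T f \<in> Y) \<and>
     (\<forall>f\<in>X. \<forall>g\<in>X. T (\<lambda>z. f z + g z) = (\<lambda>z. T f z + T g z)) \<and>
     (\<forall>c. \<forall>f\<in>X. T (\<lambda>z. c * f z) = (\<lambda>z. c * T f z)) \<and>
     (\<exists>K. \<forall>f\<in>X. N (T f) \<le> K * N f)"

definition operator_norm ::
    "(complex \<Rightarrow> complex) set \<Rightarrow> ((complex \<Rightarrow> complex) \<Rightarrow> real)
      \<Rightarrow> ((complex \<Rightarrow> complex) \<Rightarrow> complex \<Rightarrow> complex) \<Rightarrow> ennreal" where
  "operator_norm X N T = (SUP f \<in> {f \<in> X. N f \<le> 1}. ennreal (N (T f)))"

end

theory Submission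
  imports Defs
begin

text \<open>
  Write \<open>\<phi>\<^sub>a\<close> for \<open>disc_aut a\<close> and \<open>I\<close> for \<open>bmoa_integral p\<close>. The point is the inequality
  \<open>I(f \<circ> \<psi>, a) \<le> C I(f, \<psi> a)\<close> for univalent \<open>\<psi>\<close>. For \<open>p = 2\<close> it is a change of variables and the
  Schwarz--Pick lemma; for \<open>p < 2\<close> the factor \<open>(\<bar>\<psi>'(z)\<bar> (1 - \<bar>z\<bar>\<^sup>2)) powr (p - 2)\<close> left over by the
  change of variables points the wrong way.

  Instead, \<open>\<bar>f'(\<psi> z)\<bar> powr p\<close> is dominated by a conformally invariant average of
  \<open>\<bar>f'(u)\<bar> powr p\<close>, and exchanging the integrals reduces the claim to a bound for a kernel integral
  over \<open>z\<close> with \<open>u\<close> fixed. With \<open>H = \<phi>\<^sub>u \<circ> \<psi>\<close> and \<open>c = 1 - \<bar>H a\<bar>\<^sup>2\<close>, Young's inequality bounds that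
  kernel by \<open>c \<bar>H'\<bar>\<^sup>2\<close>, whose integral is at most \<open>c\<close> because \<open>H\<close> is univalent, and
  \<open>(1 - \<bar>H\<bar>\<^sup>2)\<^sup>3 \<bar>\<phi>\<^sub>a'\<bar>\<^sup>2 / c\<close>. For the latter take \<open>a = 0\<close>, so that \<open>H = \<phi>\<^sub>b \<circ> \<Psi>\<close> with \<open>b = H 0\<close>
  and \<open>\<Psi> 0 = 0\<close>: then \<open>1 - \<bar>H\<bar>\<^sup>2\<close> is at most \<open>c\<close> times the positive harmonic function
  \<open>Re ((1 + cnj b \<Psi>) / (1 - cnj b \<Psi>))\<close>, and by the Schwarz lemma at most \<open>4 c / (1 - \<bar>b z\<bar>\<^sup>2)\<close>, so
  the mean value property leaves an explicit radial integral of order \<open>c\<^sup>2\<close>.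

  For \<open>VMOA\<close> and \<open>\<bar>a\<bar> \<rightarrow> 1\<close>: if \<open>\<bar>\<psi> a\<bar>\<close> is close to \<open>1\<close>, the inequality suffices. Otherwise dominated
  convergence in \<open>u\<close> applies, because the kernel integral is at most \<open>I(H, a)\<close>, and this tends to
  \<open>0\<close> for univalent \<open>H\<close>: \<open>\<phi>\<^sub>a' \<rightarrow> 0\<close> pointwise while \<open>H'\<close> is square integrable.
\<close>

section \<open>Self-maps of the disc\<close>

definition conf_radius :: "complex \<Rightarrow> real" where
  "conf_radius z = 1 - (norm z)\<^sup>2"

definition disc_self_map :: "(complex \<Rightarrow> complex) \<Rightarrow> bool" where
  "disc_self_map \<psi> \<longleftrightarrow> \<psi> holomorphic_on unit_disc \<and> \<psi> ` unit_disc \<subseteq> unit_disc"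

definition univalent_self_map :: "(complex \<Rightarrow> complex) \<Rightarrow> bool" where
  "univalent_self_map \<psi> \<longleftrightarrow> disc_self_map \<psi> \<and> inj_on \<psi> unit_disc"

lemma conf_radius_pos_iff: "0 < conf_radius z \<longleftrightarrow> norm z < 1"
  by (simp add: conf_radius_def abs_square_less_1)

lemmas conf_radius_pos = conf_radius_pos_iff[THEN iffD2]

lemma conf_radius_nonneg: "norm z < 1 \<Longrightarrow> 0 \<le> conf_radius z"
  using conf_radius_pos by (rule less_imp_le)

lemma conf_radius_le_one: "conf_radius z \<le> 1"
  by (simp add: conf_radius_def)

lemma conf_radius_minus [simp]: "conf_radius (- z) = conf_radius z"
  by (simp add: conf_radius_def)

lemma univalent_self_mapD:
  assumes "univalent_self_map \<psi>"
  shows "disc_self_map \<psi>" and "inj_on \<psi> unit_disc"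
  using assms by (simp_all add: univalent_self_map_def)

lemma disc_self_map_holomorphic: "disc_self_map \<psi> \<Longrightarrow> \<psi> holomorphic_on unit_disc"
  by (simp add: disc_self_map_def)

lemma disc_self_map_norm_less_one: "disc_self_map \<psi> \<Longrightarrow> norm z < 1 \<Longrightarrow> norm (\<psi> z) < 1"
  by (simp add: disc_self_map_def image_subset_iff)

lemma holomorphic_on_comp_disc_self_map:
  "f holomorphic_on unit_disc \<Longrightarrow> disc_self_map \<psi> \<Longrightarrow> (f \<circ> \<psi>) holomorphic_on unit_disc"
  unfolding disc_self_map_def by (blast intro: holomorphic_on_compose_gen)

lemma disc_self_map_comp: "disc_self_map \<phi> \<Longrightarrow> disc_self_map \<psi> \<Longrightarrow> disc_self_map (\<phi> \<circ> \<psi>)"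
  using holomorphic_on_comp_disc_self_map[of \<phi> \<psi>] by (auto simp: disc_self_map_def)

lemma univalent_self_map_comp:
  "univalent_self_map \<phi> \<Longrightarrow> univalent_self_map \<psi> \<Longrightarrow> univalent_self_map (\<phi> \<circ> \<psi>)"
  unfolding univalent_self_map_def
  by (metis comp_inj_on disc_self_map_comp disc_self_map_def inj_on_subset)

lemma norm_deriv_comp_disc_self_map:
  assumes "f holomorphic_on unit_disc" "disc_self_map \<psi>" "norm z < 1"
  shows "norm (deriv (f \<circ> \<psi>) z) = norm (deriv f (\<psi> z)) * norm (deriv \<psi> z)"
proof -
  have "deriv (f \<circ> \<psi>) z = deriv f (\<psi> z) * deriv \<psi> z"
    using assms disc_self_map_norm_less_one[OF assms(2,3)]
    by (intro deriv_chain)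
      (auto simp: disc_self_map_def intro: holomorphic_on_imp_differentiable_at)
  then show ?thesis
    by (simp add: norm_mult)
qed

lemma disc_aut_zero_left: "disc_aut 0 z = - z"
  by (simp add: disc_aut_def)

lemma disc_aut_zero_right: "disc_aut a 0 = a"
  by (simp add: disc_aut_def)

lemma disc_aut_self: "disc_aut a a = 0"
  by (simp add: disc_aut_def)

lemma norm_disc_aut_denom_ge: "norm (1 - cnj a * z) \<ge> 1 - norm a * norm z"
  using norm_triangle_ineq2[of 1 "cnj a * z"] by (simp add: norm_mult)

lemma disc_aut_denom_nonzero: "norm a < 1 \<Longrightarrow> norm z < 1 \<Longrightarrow> 1 - cnj a * z \<noteq> 0"
  using norm_disc_aut_denom_ge[of a z] mult_strict_mono[of "norm a" 1 "norm z" 1] by auto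

lemma conf_radius_disc_aut:
  assumes "norm a < 1" "norm z < 1"
  shows "conf_radius (disc_aut a z) = conf_radius a * conf_radius z / (norm (1 - cnj a * z))\<^sup>2"
proof -
  have "(norm (1 - cnj a * z))\<^sup>2 - (norm (a - z))\<^sup>2 = conf_radius a * conf_radius z"
    unfolding conf_radius_def cmod_power2 by (simp add: power2_eq_square algebra_simps)
  moreover have "conf_radius (disc_aut a z)
      = ((norm (1 - cnj a * z))\<^sup>2 - (norm (a - z))\<^sup>2) / (norm (1 - cnj a * z))\<^sup>2"
    using disc_aut_denom_nonzero[OF assms]
    by (simp add: conf_radius_def disc_aut_def norm_divide power_divide field_simps)
  ultimately show ?thesis by simp
qed

lemma conf_radius_disc_aut_pos:
  "norm a < 1 \<Longrightarrow> norm z < 1 \<Longrightarrow> 0 < conf_radius (disc_aut a z)"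
  using disc_aut_denom_nonzero[of a z] by (simp add: conf_radius_disc_aut conf_radius_pos)

lemma disc_self_map_disc_aut: "norm a < 1 \<Longrightarrow> disc_self_map (disc_aut a)"
  using disc_aut_denom_nonzero[of a] conf_radius_disc_aut_pos[of a]
  unfolding disc_self_map_def conf_radius_pos_iff disc_aut_def
  by (auto intro!: holomorphic_intros)

lemma disc_aut_disc_aut:
  assumes "norm a < 1" "norm z < 1"
  shows "disc_aut a (disc_aut a z) = z"
proof -
  have denom_nonzero: "1 - cnj a * z \<noteq> 0" "1 - cnj a * a \<noteq> 0"
    using disc_aut_denom_nonzero assms by auto
  then have "a - (a - z) / (1 - cnj a * z) = (1 - cnj a * a) * z / (1 - cnj a * z)"
    "1 - cnj a * ((a - z) / (1 - cnj a * z)) = (1 - cnj a * a) / (1 - cnj a * z)"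
    by (simp_all add: field_simps)
  then show ?thesis
    using denom_nonzero by (simp add: disc_aut_def)
qed

lemma disc_self_map_comp_disc_aut:
  "disc_self_map \<psi> \<Longrightarrow> norm a < 1 \<Longrightarrow> disc_self_map (\<psi> \<circ> disc_aut a)"
  by (simp add: disc_self_map_comp disc_self_map_disc_aut)

lemma disc_self_map_disc_aut_comp:
  "norm a < 1 \<Longrightarrow> disc_self_map \<psi> \<Longrightarrow> disc_self_map (disc_aut a \<circ> \<psi>)"
  by (simp add: disc_self_map_comp disc_self_map_disc_aut)

lemma univalent_self_map_disc_aut: "norm a < 1 \<Longrightarrow> univalent_self_map (disc_aut a)"
  unfolding univalent_self_map_def
  by (metis disc_self_map_disc_aut disc_aut_disc_aut inj_onI mem_ball_0)

lemma univalent_self_map_disc_aut_comp: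
  "norm a < 1 \<Longrightarrow> univalent_self_map \<psi> \<Longrightarrow> univalent_self_map (disc_aut a \<circ> \<psi>)"
  by (simp add: univalent_self_map_comp univalent_self_map_disc_aut)

lemma image_disc_aut: "norm a < 1 \<Longrightarrow> disc_aut a ` unit_disc = unit_disc"
  using disc_self_map_norm_less_one[OF disc_self_map_disc_aut]
  by (force simp: image_iff intro: disc_aut_disc_aut[symmetric])

lemma conf_radius_disc_aut_commute: "conf_radius (disc_aut a z) = conf_radius (disc_aut z a)"
proof -
  have "norm (1 - cnj a * z) = norm (1 - cnj z * a)"
    by (subst complex_mod_cnj[symmetric]) (simp add: mult.commute)
  then show ?thesis
    by (simp add: conf_radius_def disc_aut_def norm_divide norm_minus_commute)
qed

lemma norm_deriv_disc_aut:
  assumes "norm a < 1" "norm z < 1"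
  shows "norm (deriv (disc_aut a) z) = conf_radius a / (norm (1 - cnj a * z))\<^sup>2"
proof -
  have "(disc_aut a has_field_derivative
     ((-1) * (1 - cnj a * z) - (a - z) * (- cnj a)) / ((1 - cnj a * z) * (1 - cnj a * z))) (at z)"
    unfolding disc_aut_def using disc_aut_denom_nonzero[OF assms]
    by (auto intro!: derivative_eq_intros)
  then have "deriv (disc_aut a) z = - (1 - cnj a * a) / (1 - cnj a * z)\<^sup>2"
    by (simp add: DERIV_imp_deriv algebra_simps power2_eq_square)
  moreover have "1 - cnj a * a = of_real (conf_radius a)"
    by (simp add: conf_radius_def mult.commute flip: complex_norm_square)
  ultimately show ?thesis
    using conf_radius_nonneg[OF assms(1)] by (simp add: norm_divide norm_power)
qed

lemma norm_deriv_disc_aut_mult_conf_radius: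
  "norm a < 1 \<Longrightarrow> norm z < 1 \<Longrightarrow>
    norm (deriv (disc_aut a) z) * conf_radius z = conf_radius (disc_aut a z)"
  by (simp add: norm_deriv_disc_aut conf_radius_disc_aut)

lemma norm_deriv_disc_aut_pos:
  "norm a < 1 \<Longrightarrow> norm z < 1 \<Longrightarrow> 0 < norm (deriv (disc_aut a) z)"
  using norm_deriv_disc_aut_mult_conf_radius[of a z] conf_radius_disc_aut_pos[of a z] by auto

lemma conf_radius_disc_aut_le_product:
  assumes "norm a < 1" "norm z < 1"
  shows "conf_radius (disc_aut a z) \<le> 4 * conf_radius a / (1 - (norm a)\<^sup>2 * (norm z)\<^sup>2)"
proof -
  define d q where "d = norm (1 - cnj a * z)" and "q = norm a * norm z"
  have q_bounds: "0 \<le> q" "q < 1" "1 - q \<le> d"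
    using mult_strict_mono[of "norm a" 1 "norm z" 1] norm_disc_aut_denom_ge assms
    by (auto simp: q_def d_def)
  have "1 - q\<^sup>2 = (1 - q) * (1 + q)"
    by (simp add: power2_eq_square algebra_simps)
  also have "\<dots> \<le> d * 2"
    using q_bounds by (intro mult_mono) auto
  finally have "1 - q\<^sup>2 \<le> 2 * d"
    by simp
  moreover have "conf_radius z \<le> 1 - q\<^sup>2"
    using assms by (simp add: conf_radius_def q_def power_mult_distrib power_le_one
        mult_left_le_one_le)
  moreover have "0 < 1 - q\<^sup>2"
    using q_bounds by (simp add: abs_square_less_1)
  ultimately have "conf_radius z * (1 - q\<^sup>2) \<le> (2 * d) * (2 * d)"
    using conf_radius_nonneg[OF assms(2)] by (intro mult_mono) auto
  then have "conf_radius z / d\<^sup>2 \<le> 4 / (1 - q\<^sup>2)"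
    using q_bounds \<open>0 < 1 - q\<^sup>2\<close> by (simp add: field_simps power2_eq_square)
  then have "conf_radius a * (conf_radius z / d\<^sup>2) \<le> conf_radius a * (4 / (1 - q\<^sup>2))"
    using conf_radius_nonneg[OF assms(1)] by (rule mult_left_mono)
  then show ?thesis
    by (simp add: conf_radius_disc_aut[OF assms] d_def q_def power_mult_distrib mult.commute)
qed

lemma conf_radius_disc_aut_le:
  assumes "norm a < 1" "norm z < 1"
  shows "conf_radius (disc_aut a z) \<le> 4 * conf_radius a / conf_radius z"
proof -
  have "(norm a)\<^sup>2 * (norm z)\<^sup>2 \<le> (norm z)\<^sup>2"
    using assms by (intro mult_left_le_one_le) (auto simp: power_le_one)
  then have "4 * conf_radius a / (1 - (norm a)\<^sup>2 * (norm z)\<^sup>2) \<le> 4 * conf_radius a / conf_radius z"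
    using conf_radius_pos[OF assms(1)] conf_radius_pos[OF assms(2)]
    by (intro divide_left_mono mult_pos_pos) (auto simp: conf_radius_def)
  with conf_radius_disc_aut_le_product[OF assms] show ?thesis
    by (rule order_trans)
qed

definition herglotz_kernel :: "complex \<Rightarrow> complex \<Rightarrow> complex" where
  "herglotz_kernel a z = (1 + cnj a * z) / (1 - cnj a * z)"

lemma conf_radius_disc_aut_le_Re_herglotz_kernel:
  assumes "norm a < 1" "norm z < 1"
  shows "conf_radius (disc_aut a z) \<le> conf_radius a * Re (herglotz_kernel a z)"
proof -
  have "Re (herglotz_kernel a z) = (1 - (norm a)\<^sup>2 * (norm z)\<^sup>2) / (norm (1 - cnj a * z))\<^sup>2"
    by (simp add: herglotz_kernel_def Re_divide' cmod_power2[of a] cmod_power2[of z]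
        power2_eq_square[of "Re _"] power2_eq_square[of "Im _"] algebra_simps)
  moreover have "conf_radius z \<le> 1 - (norm a)\<^sup>2 * (norm z)\<^sup>2"
    using assms by (simp add: conf_radius_def power_le_one mult_left_le_one_le)
  ultimately show ?thesis
    using conf_radius_nonneg[OF assms(1)]
    by (simp add: conf_radius_disc_aut[OF assms] mult_left_mono divide_right_mono)
qed

lemma Re_herglotz_kernel_pos:
  assumes "norm a < 1" "norm z < 1"
  shows "0 < Re (herglotz_kernel a z)"
  using less_le_trans[OF conf_radius_disc_aut_pos[OF assms]
      conf_radius_disc_aut_le_Re_herglotz_kernel[OF assms]] conf_radius_pos[OF assms(1)]
  by (simp add: zero_less_mult_iff)

lemma holomorphic_on_herglotz_kernel:
  "norm a < 1 \<Longrightarrow> herglotz_kernel a holomorphic_on unit_disc"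
  unfolding herglotz_kernel_def using disc_aut_denom_nonzero by (auto intro!: holomorphic_intros)

text \<open>
  The bound is a harmonic function times a radial weight, so that the mean value property evaluates
  its integral.
\<close>

lemma conf_radius_disc_aut_cube_le:
  assumes a: "norm a < 1" and z: "norm z < 1" and r: "norm z \<le> r" "r < 1"
  shows "conf_radius (disc_aut a z) ^ 3 \<le> 16 * conf_radius a ^ 3
    * (Re (herglotz_kernel a z) * (1 / (1 - (norm a)\<^sup>2 * r\<^sup>2)\<^sup>2))"
proof -
  define k c P where "k = conf_radius (disc_aut a z)" and "c = conf_radius a"
    and "P = Re (herglotz_kernel a z)"
  have k_pos: "0 < k" and c_pos: "0 < c"
    using conf_radius_disc_aut_pos[OF a z] conf_radius_pos[OF a] by (simp_all add: k_def c_def)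
  have k_le: "k \<le> c * P"
    unfolding k_def c_def P_def using a z by (rule conf_radius_disc_aut_le_Re_herglotz_kernel)
  have r_nonneg: "0 \<le> r"
    using r(1) norm_ge_zero order_trans by blast
  then have "norm a * r < 1"
    using a r mult_strict_mono[of "norm a" 1 r 1] by simp
  then have denom_pos: "0 < 1 - (norm a)\<^sup>2 * r\<^sup>2"
    using r_nonneg by (simp add: abs_square_less_1 flip: power_mult_distrib)
  have "(norm a)\<^sup>2 * (norm z)\<^sup>2 \<le> (norm a)\<^sup>2 * r\<^sup>2"
    using r by (intro mult_left_mono power_mono) auto
  then have "4 * c / (1 - (norm a)\<^sup>2 * (norm z)\<^sup>2) \<le> 4 * c / (1 - (norm a)\<^sup>2 * r\<^sup>2)"
    using c_pos denom_pos by (intro divide_left_mono mult_pos_pos) auto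
  then have "k \<le> 4 * c / (1 - (norm a)\<^sup>2 * r\<^sup>2)"
    unfolding k_def c_def using conf_radius_disc_aut_le_product[OF a z] by simp
  then have "k\<^sup>2 \<le> (4 * c / (1 - (norm a)\<^sup>2 * r\<^sup>2))\<^sup>2"
    using k_pos by (intro power_mono) auto
  with k_le have "k * k\<^sup>2 \<le> c * P * (4 * c / (1 - (norm a)\<^sup>2 * r\<^sup>2))\<^sup>2"
    using k_pos by (intro mult_mono) auto
  then show ?thesis
    by (simp add: k_def c_def P_def power2_eq_square power3_eq_cube mult_ac)
qed

lemma Schwarz_Pick:
  assumes H: "disc_self_map H" and a: "norm a < 1" and z: "norm z < 1"
  shows "norm (disc_aut (H a) (H z)) \<le> norm (disc_aut a z)"
proof -
  define F where "F = disc_aut (H a) \<circ> H \<circ> disc_aut a"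
  have F: "disc_self_map F"
    unfolding F_def using H a
    by (simp add: disc_self_map_comp_disc_aut disc_self_map_disc_aut_comp
        disc_self_map_norm_less_one)
  have "F 0 = 0"
    by (simp add: F_def disc_aut_zero_right disc_aut_self)
  with disc_self_map_holomorphic[OF F] have "norm (F (disc_aut a z)) \<le> norm (disc_aut a z)"
    using disc_self_map_norm_less_one[OF F]
      disc_self_map_norm_less_one[OF disc_self_map_disc_aut[OF a] z]
    by (rule Schwarz_Lemma(1))
  then show ?thesis
    by (simp add: F_def disc_aut_disc_aut a z)
qed

lemma conf_radius_comp_le:
  assumes H: "disc_self_map H" and a: "norm a < 1" and z: "norm z < 1"
  shows "conf_radius (disc_aut a z) * conf_radius (H z) \<le> 4 * conf_radius (H a)"
proof -
  note less_one = disc_self_map_norm_less_one[OF H]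
  have "conf_radius (disc_aut a z) \<le> conf_radius (disc_aut (H a) (H z))"
    unfolding conf_radius_def using Schwarz_Pick[OF H a z] by (simp add: power_mono)
  also have "\<dots> \<le> 4 * conf_radius (H a) / conf_radius (H z)"
    using less_one a z by (intro conf_radius_disc_aut_le) auto
  finally show ?thesis
    using conf_radius_pos[OF less_one[OF z]] by (simp add: field_simps)
qed

definition hyp_deriv :: "(complex \<Rightarrow> complex) \<Rightarrow> complex \<Rightarrow> real" where
  "hyp_deriv H z = norm (deriv H z) / conf_radius (H z)"

lemma hyp_deriv_disc_aut_comp:
  assumes \<psi>: "disc_self_map \<psi>" and u: "norm u < 1" and z: "norm z < 1"
  shows "hyp_deriv (disc_aut u \<circ> \<psi>) z = hyp_deriv \<psi> z"
proof -
  note \<psi>z = disc_self_map_norm_less_one[OF \<psi> z]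
  show ?thesis
    using norm_deriv_disc_aut_pos[OF u \<psi>z]
    by (simp add: hyp_deriv_def u z \<psi> \<psi>z disc_self_map_holomorphic[OF disc_self_map_disc_aut]
        norm_deriv_comp_disc_self_map flip: norm_deriv_disc_aut_mult_conf_radius)
qed

section \<open>Univalent changes of variables\<close>

text \<open>The library's theorem on differentiable images is for \<^typ>\<open>real^'n\<close>.\<close>

definition vec2_to_complex :: "real^2 \<Rightarrow> complex" where
  "vec2_to_complex x = Complex (x$1) (x$2)"

definition complex_to_vec2 :: "complex \<Rightarrow> real^2" where
  "complex_to_vec2 z = vector [Re z, Im z]"

lemma vec2_to_complex_inverse [simp]: "complex_to_vec2 (vec2_to_complex x) = x"
  by (simp add: vec2_to_complex_def complex_to_vec2_def vec_eq_iff forall_2)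

lemma complex_to_vec2_inverse [simp]: "vec2_to_complex (complex_to_vec2 z) = z"
  by (simp add: vec2_to_complex_def complex_to_vec2_def)

lemma linear_vec2_to_complex: "linear vec2_to_complex"
  by (rule linearI) (simp_all add: vec2_to_complex_def complex_eq_iff)

lemma linear_complex_to_vec2: "linear complex_to_vec2"
  by (rule linearI) (simp_all add: complex_to_vec2_def vec_eq_iff forall_2)

lemma vimage_vec2_to_complex: "vec2_to_complex -` A = complex_to_vec2 ` A"
  by (auto simp: image_iff) (metis vec2_to_complex_inverse)

lemma measurable_vec2_to_complex [measurable]: "vec2_to_complex \<in> borel \<rightarrow>\<^sub>M borel"
  using linear_vec2_to_complex
  by (intro borel_measurable_continuous_onI)
    (simp add: linear_continuous_on linear_conv_bounded_linear)

lemma lborel_complex_eq_distr: "(lborel :: complex measure) = distr lborel borel vec2_to_complex"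
proof (rule lborel_eqI)
  fix l u :: complex
  assume l_le_u: "\<And>b. b \<in> Basis \<Longrightarrow> l \<bullet> b \<le> u \<bullet> b"
  have Basis_vec2: "(Basis :: (real^2) set) = {axis 1 1, axis 2 1}"
    by (auto simp: Basis_vec_def UNIV_2)
  have "axis 1 1 \<noteq> (axis 2 1 :: real^2)"
    by (simp add: axis_eq_axis)
  moreover have "vec2_to_complex -` box l u = box (complex_to_vec2 l) (complex_to_vec2 u)"
    by (auto simp: box_def Basis_complex_def Basis_vec2 vec2_to_complex_def complex_to_vec2_def
        inner_axis)
  moreover have "Re l \<le> Re u" "Im l \<le> Im u"
    using l_le_u[of 1] l_le_u[of \<i>] by (auto simp: Basis_complex_def)
  ultimately show "emeasure (distr lborel borel vec2_to_complex) (box l u)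
      = (\<Prod>b\<in>Basis. (u - l) \<bullet> b)"
    by (simp add: emeasure_distr emeasure_lborel_box_eq Basis_vec2 Basis_complex_def
        inner_axis complex_to_vec2_def)
qed simp

lemma nn_integral_lborel_complex:
  assumes "F \<in> borel_measurable borel"
  shows "(\<integral>\<^sup>+z. F z \<partial>lborel) = (\<integral>\<^sup>+x. F (vec2_to_complex x) \<partial>lborel)"
  using assms by (subst lborel_complex_eq_distr) (simp add: nn_integral_distr)

lemma sets_image_complex_to_vec2: "A \<in> sets borel \<Longrightarrow> complex_to_vec2 ` A \<in> sets borel"
  using measurable_sets_borel[OF measurable_vec2_to_complex] by (simp add: vimage_vec2_to_complex)

lemma emeasure_lborel_complex:
  assumes "A \<in> sets borel"
  shows "emeasure lborel A = emeasure lborel (complex_to_vec2 ` A)"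
  using assms
  by (subst lborel_complex_eq_distr) (simp add: emeasure_distr vimage_vec2_to_complex)

lemma det_matrix_complex_mult:
  "det (matrix (complex_to_vec2 \<circ> (*) c \<circ> vec2_to_complex)) = (norm c)\<^sup>2"
  unfolding cmod_power2
  by (simp add: det_2 matrix_def complex_to_vec2_def vec2_to_complex_def axis_def power2_eq_square)

lemma has_derivative_vec2_conjugate:
  assumes "(g has_field_derivative c) (at (vec2_to_complex x))"
  shows "((complex_to_vec2 \<circ> g \<circ> vec2_to_complex) has_derivative
    (complex_to_vec2 \<circ> (*) c \<circ> vec2_to_complex)) (at x)"
  using assms linear_vec2_to_complex linear_complex_to_vec2
  by (intro diff_chain_at linear_imp_has_derivative) (simp_all add: has_field_derivative_def)

lemma has_integral_norm_deriv_sq_vec2: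
  assumes hol: "g holomorphic_on U" "open U" and inj: "inj_on g U"
    and E: "E \<in> sets borel" "E \<subseteq> U" and image: "complex_to_vec2 ` g ` E \<in> lmeasurable"
  shows "((\<lambda>x. (norm (deriv g (vec2_to_complex x)))\<^sup>2) has_integral
    measure lebesgue (complex_to_vec2 ` g ` E)) (complex_to_vec2 ` E)"
proof -
  define G where "G = complex_to_vec2 \<circ> g \<circ> vec2_to_complex"
  define G' where "G' = (\<lambda>x. complex_to_vec2 \<circ> (*) (deriv g (vec2_to_complex x)) \<circ> vec2_to_complex)"
  define S where "S = complex_to_vec2 ` E"
  have S_sets: "S \<in> sets lebesgue"
    using sets_image_complex_to_vec2[OF E(1)] by (simp add: S_def)
  have image_G: "G ` S = complex_to_vec2 ` g ` E"
    by (simp add: G_def S_def image_comp comp_def)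
  have "inj complex_to_vec2"
    by (metis complex_to_vec2_inverse injI)
  then have inj_G: "inj_on G S"
    by (auto simp: G_def S_def inj_eq intro!: inj_onI dest: inj_onD[OF inj_on_subset[OF inj E(2)]])
  have "(G has_derivative G' x) (at x within S)" if "x \<in> S" for x
    unfolding G_def G'_def using that E(2)
    by (intro has_derivative_at_withinI[OF has_derivative_vec2_conjugate]
        holomorphic_derivI[OF hol]) (auto simp: S_def)
  from has_measure_differentiable_image[OF S_sets this inj_G, of "measure lebesgue (G ` S)"]
  show ?thesis
    using image by (simp add: G'_def det_matrix_complex_mult image_G) (simp add: S_def)
qed

lemma nn_integral_norm_deriv_sq_eq_emeasure_image:
  fixes g :: "complex \<Rightarrow> complex"
  assumes hol: "g holomorphic_on U" "open U" and inj: "inj_on g U"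
    and E: "E \<in> sets borel" "E \<subseteq> U" and gE: "g ` E \<in> sets borel" "bounded (g ` E)"
  shows "(\<integral>\<^sup>+z\<in>E. ennreal ((norm (deriv g z))\<^sup>2) \<partial>lborel) = emeasure lborel (g ` E)"
proof -
  define J where "J = (\<lambda>z. (norm (deriv g z))\<^sup>2)"
  have "continuous_on E J"
    unfolding J_def using hol E(2)
    by (intro continuous_intros continuous_on_subset[OF holomorphic_on_imp_continuous_on]
        holomorphic_deriv)
  then have "(\<lambda>z. ennreal (indicat_real E z *\<^sub>R J z)) \<in> borel_measurable borel"
    using borel_measurable_continuous_on_indicator[OF E(1)] by measurable
  then have J_measurable: "(\<lambda>z. ennreal (J z) * indicator E z) \<in> borel_measurable borel"
    by (rule measurable_cong[THEN iffD1, rotated]) (simp add: indicator_def)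
  have image_sets: "complex_to_vec2 ` g ` E \<in> sets borel"
    using gE(1) by (rule sets_image_complex_to_vec2)
  moreover have "bounded (complex_to_vec2 ` g ` E)"
    using bounded_linear_image[OF gE(2)] linear_complex_to_vec2
    by (simp add: linear_conv_bounded_linear)
  ultimately have lmeasurable: "complex_to_vec2 ` g ` E \<in> lmeasurable"
    by (intro bounded_set_imp_lmeasurable) auto
  have "(\<integral>\<^sup>+z\<in>E. ennreal (J z) \<partial>lborel)
      = (\<integral>\<^sup>+x\<in>complex_to_vec2 ` E. ennreal (J (vec2_to_complex x)) \<partial>lborel)"
    using nn_integral_lborel_complex[OF J_measurable]
    by (simp add: indicator_def flip: vimage_vec2_to_complex)
  also have "\<dots> = ennreal (measure lebesgue (complex_to_vec2 ` g ` E))"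
    using has_integral_norm_deriv_sq_vec2[OF hol inj E lmeasurable]
    by (intro nn_integral_has_integral_lebesgue') (simp_all add: J_def)
  also have "\<dots> = emeasure lborel (g ` E)"
    using emeasure_eq_measure2[OF lmeasurable] image_sets emeasure_lborel_complex[OF gE(1)] by simp
  finally show ?thesis
    by (simp add: J_def)
qed

lemma borel_measurable_restrict_lborel_holomorphic:
  assumes "h holomorphic_on U"
  shows "h \<in> borel_measurable (restrict_space lborel U)"
  using borel_measurable_continuous_on_restrict[OF holomorphic_on_imp_continuous_on[OF assms]]
  by (simp cong: measurable_cong_sets sets_restrict_space_cong)

lemma emeasure_distr_norm_deriv_sq:
  fixes g :: "complex \<Rightarrow> complex"
  assumes hol: "g holomorphic_on U" "open U" and inj: "inj_on g U" and bdd: "bounded (g ` U)"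
    and A: "A \<in> sets borel"
  shows "emeasure (distr (density (restrict_space lborel U)
      (\<lambda>z. ennreal ((norm (deriv g z))\<^sup>2))) borel g) A = emeasure lborel (A \<inter> g ` U)"
proof -
  define U_measure where "U_measure = restrict_space lborel U"
  define J where "J = (\<lambda>z. ennreal ((norm (deriv g z))\<^sup>2))"
  define E where "E = g -` A \<inter> U"
  have U_sets: "U \<in> sets borel" and gU_sets: "g ` U \<in> sets borel"
    using open_mapping_thm3[OF hol inj] hol(2) by auto
  have g_measurable: "g \<in> borel_measurable U_measure"
    unfolding U_measure_def by (rule borel_measurable_restrict_lborel_holomorphic[OF hol(1)])
  have "deriv g \<in> borel_measurable U_measure"
    unfolding U_measure_def
    by (rule borel_measurable_restrict_lborel_holomorphic[OF holomorphic_deriv[OF hol]])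
  then have [measurable]: "J \<in> borel_measurable U_measure"
    unfolding J_def by measurable
  have image: "g ` E = A \<inter> g ` U"
    by (auto simp: E_def)
  have vimage: "g -` A \<inter> space U_measure = E"
    by (simp add: E_def U_measure_def space_restrict_space)
  with measurable_sets[OF g_measurable A] have E: "E \<in> sets U_measure"
    by simp
  then have E_borel: "E \<in> sets borel"
    using U_sets by (auto simp: U_measure_def sets_restrict_space)
  have "emeasure (distr (density U_measure J) borel g) A = (\<integral>\<^sup>+z\<in>E. J z \<partial>U_measure)"
    using A g_measurable E vimage by (simp add: emeasure_distr emeasure_density)
  also have "\<dots> = (\<integral>\<^sup>+z\<in>E. J z \<partial>lborel)"
    unfolding U_measure_def using U_sets
    by (subst nn_integral_restrict_space) (auto intro!: nn_integral_cong simp: E_def indicator_def)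
  also have "\<dots> = emeasure lborel (A \<inter> g ` U)"
    unfolding J_def image[symmetric] using E_borel A gU_sets bounded_subset[OF bdd]
    by (intro nn_integral_norm_deriv_sq_eq_emeasure_image[OF hol inj])
      (auto simp: image, auto simp: E_def)
  finally show ?thesis
    by (simp add: U_measure_def J_def)
qed

lemma nn_integral_univalent_substitution:
  fixes g :: "complex \<Rightarrow> complex"
  assumes hol: "g holomorphic_on U" "open U" and inj: "inj_on g U" and bdd: "bounded (g ` U)"
    and F [measurable]: "F \<in> borel_measurable borel"
  shows "(\<integral>\<^sup>+z\<in>U. F (g z) * ennreal ((norm (deriv g z))\<^sup>2) \<partial>lborel) = (\<integral>\<^sup>+w\<in>g ` U. F w \<partial>lborel)"
proof -
  define J where "J = (\<lambda>z. ennreal ((norm (deriv g z))\<^sup>2))"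
  define M where "M = distr (density (restrict_space lborel U) J) borel g"
  have [measurable]: "U \<in> sets borel" "g ` U \<in> sets borel"
    using open_mapping_thm3[OF hol inj] hol(2) by auto
  note [measurable] = borel_measurable_restrict_lborel_holomorphic[OF hol(1)]
    borel_measurable_restrict_lborel_holomorphic[OF holomorphic_deriv[OF hol]]
  have "M = density lborel (indicator (g ` U))"
    by (rule measure_eqI)
      (auto simp: M_def J_def emeasure_distr_norm_deriv_sq[OF hol inj bdd] emeasure_density
        Int_commute simp flip: indicator_inter_arith)
  then have "(\<integral>\<^sup>+w. F w \<partial>M) = (\<integral>\<^sup>+w. F w \<partial>density lborel (indicator (g ` U)))"
    by simp
  then have "(\<integral>\<^sup>+z. J z * F (g z) \<partial>restrict_space lborel U)
      = (\<integral>\<^sup>+w. indicator (g ` U) w * F w \<partial>lborel)"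
    by (simp add: M_def J_def nn_integral_distr nn_integral_density)
  then show ?thesis
    by (simp add: nn_integral_restrict_space J_def mult_ac)
qed

section \<open>The disc measure\<close>

lemma borel_measurable_conf_radius [measurable]:
  "f \<in> borel_measurable M \<Longrightarrow> (\<lambda>x. conf_radius (f x)) \<in> borel_measurable M"
  unfolding conf_radius_def by measurable

lemma borel_measurable_disc_aut [measurable]:
  assumes [measurable]: "f \<in> borel_measurable M" "g \<in> borel_measurable M"
  shows "(\<lambda>x. disc_aut (f x) (g x)) \<in> borel_measurable M"
proof -
  have "cnj \<in> borel_measurable borel"
    by (intro borel_measurable_continuous_onI continuous_intros)
  then have [measurable]: "(\<lambda>x. cnj (f x)) \<in> borel_measurable M"
    by (rule measurable_compose[OF assms(1)])
  show ?thesis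
    unfolding disc_aut_def by measurable
qed

lemma space_disc_measure [simp]: "space disc_measure = unit_disc"
  by (simp add: disc_measure_def space_restrict_space space_scale_measure)

lemma sets_disc_measure: "sets disc_measure = sets (restrict_space borel unit_disc)"
  by (simp add: disc_measure_def sets_restrict_space)

lemma measurable_disc_measure_ident [measurable]: "(\<lambda>z. z) \<in> disc_measure \<rightarrow>\<^sub>M borel"
  unfolding measurable_cong_sets[OF sets_disc_measure refl]
  by (rule measurable_restrict_space1) simp

lemma measurable_disc_measureI:
  assumes "f \<in> M \<rightarrow>\<^sub>M borel" "\<And>x. x \<in> space M \<Longrightarrow> norm (f x) < 1"
  shows "f \<in> M \<rightarrow>\<^sub>M disc_measure"
proof -
  have "f \<in> space M \<rightarrow> unit_disc"
    using assms(2) by auto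
  then have "f \<in> M \<rightarrow>\<^sub>M restrict_space borel unit_disc"
    using assms(1) by (rule measurable_restrict_space2)
  then show ?thesis
    by (subst measurable_cong_sets[OF refl sets_disc_measure])
qed

lemma borel_measurable_disc_holomorphic:
  assumes "h holomorphic_on unit_disc"
  shows "h \<in> borel_measurable disc_measure" "deriv h \<in> borel_measurable disc_measure"
  using assms holomorphic_deriv[OF assms]
  unfolding measurable_cong_sets[OF sets_disc_measure refl]
  by (auto intro!: borel_measurable_continuous_on_restrict holomorphic_on_imp_continuous_on)

lemmas borel_measurable_disc_self_map =
  borel_measurable_disc_holomorphic[OF disc_self_map_holomorphic]

lemma nn_integral_disc_measure:
  assumes "F \<in> borel_measurable disc_measure"
  shows "nn_integral disc_measure F = ennreal (1 / pi) * (\<integral>\<^sup>+z\<in>unit_disc. F z \<partial>lborel)"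
proof -
  have "F \<in> borel_measurable (restrict_space lborel unit_disc)"
    using assms by (simp add: disc_measure_def cong: measurable_cong_sets)
  then show ?thesis
    unfolding disc_measure_def by (simp add: nn_integral_scale_measure nn_integral_restrict_space)
qed

lemma emeasure_disc_measure:
  assumes "A \<in> sets borel" "A \<subseteq> unit_disc"
  shows "emeasure disc_measure A = ennreal (1 / pi) * emeasure lborel A"
  using assms by (simp add: disc_measure_def emeasure_restrict_space)

lemma emeasure_disc_measure_disc [simp]: "emeasure disc_measure unit_disc = 1"
  by (simp add: emeasure_disc_measure emeasure_ball unit_ball_vol_2 flip: ennreal_mult)

interpretation disc: finite_measure disc_measure
  by (rule finite_measureI) simp

lemma nn_integral_disc_substitution:
  assumes \<psi>: "univalent_self_map \<psi>" and F: "F \<in> borel_measurable disc_measure"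
  shows "(\<integral>\<^sup>+z. F (\<psi> z) * ennreal ((norm (deriv \<psi> z))\<^sup>2) \<partial>disc_measure)
    = (\<integral>\<^sup>+w\<in>\<psi> ` unit_disc. F w \<partial>disc_measure)"
proof -
  have self: "disc_self_map \<psi>" and inj: "inj_on \<psi> unit_disc"
    using univalent_self_mapD[OF \<psi>] by auto
  then have hol: "\<psi> holomorphic_on unit_disc" and sub: "\<psi> ` unit_disc \<subseteq> unit_disc"
    by (auto simp: disc_self_map_def)
  define J where "J = (\<lambda>z. ennreal ((norm (deriv \<psi> z))\<^sup>2))"
  define F\<^sub>0 where "F\<^sub>0 = (\<lambda>w. F w * indicator unit_disc w)"
  have [measurable]: "F\<^sub>0 \<in> borel_measurable borel"
    using F unfolding F\<^sub>0_def measurable_cong_sets[OF sets_disc_measure refl]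
    by (subst (asm) borel_measurable_restrict_space_iff_ennreal) auto
  note [measurable] = borel_measurable_disc_holomorphic[OF hol]
  have [measurable]: "\<psi> ` unit_disc \<in> sets borel"
    using open_mapping_thm3[OF hol _ inj] by auto
  have "(\<integral>\<^sup>+z. F (\<psi> z) * J z \<partial>disc_measure) = (\<integral>\<^sup>+z. F\<^sub>0 (\<psi> z) * J z \<partial>disc_measure)"
    by (intro nn_integral_cong) (simp add: F\<^sub>0_def disc_self_map_norm_less_one[OF self])
  also have "\<dots> = ennreal (1 / pi) * (\<integral>\<^sup>+z\<in>unit_disc. F\<^sub>0 (\<psi> z) * J z \<partial>lborel)"
    by (rule nn_integral_disc_measure) (simp add: J_def)
  also have "(\<integral>\<^sup>+z\<in>unit_disc. F\<^sub>0 (\<psi> z) * J z \<partial>lborel) = (\<integral>\<^sup>+w\<in>\<psi> ` unit_disc. F\<^sub>0 w \<partial>lborel)"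
    unfolding J_def using hol inj sub
    by (intro nn_integral_univalent_substitution) (auto intro: bounded_subset[OF bounded_ball])
  also have "\<dots> = (\<integral>\<^sup>+w\<in>unit_disc. F\<^sub>0 w * indicator (\<psi> ` unit_disc) w \<partial>lborel)"
    using sub by (intro nn_integral_cong) (auto simp: indicator_def)
  also have "ennreal (1 / pi) * \<dots> = (\<integral>\<^sup>+w\<in>\<psi> ` unit_disc. F\<^sub>0 w \<partial>disc_measure)"
    by (rule nn_integral_disc_measure[symmetric]) simp
  also have "\<dots> = (\<integral>\<^sup>+w\<in>\<psi> ` unit_disc. F w \<partial>disc_measure)"
    by (intro nn_integral_cong) (simp add: F\<^sub>0_def)
  finally show ?thesis
    by (simp add: J_def)
qed

lemma nn_integral_norm_deriv_sq_le:
  assumes "univalent_self_map \<psi>"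
  shows "(\<integral>\<^sup>+z. ennreal ((norm (deriv \<psi> z))\<^sup>2) \<partial>disc_measure) \<le> 1"
proof -
  have "(\<integral>\<^sup>+z. ennreal ((norm (deriv \<psi> z))\<^sup>2) \<partial>disc_measure)
      = (\<integral>\<^sup>+w\<in>\<psi> ` unit_disc. 1 \<partial>disc_measure)"
    using nn_integral_disc_substitution[OF assms, of "\<lambda>_. 1"] by simp
  also have "\<dots> \<le> (\<integral>\<^sup>+w. 1 \<partial>disc_measure)"
    by (intro nn_integral_mono) (simp add: indicator_def)
  finally show ?thesis by simp
qed

lemma nn_integral_disc_aut_substitution:
  assumes a: "norm a < 1" and F: "F \<in> borel_measurable disc_measure"
  shows "(\<integral>\<^sup>+z. F (disc_aut a z) * ennreal ((norm (deriv (disc_aut a) z))\<^sup>2) \<partial>disc_measure)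
    = (\<integral>\<^sup>+w. F w \<partial>disc_measure)"
  using nn_integral_disc_substitution[OF univalent_self_map_disc_aut[OF a] F]
  by (simp add: image_disc_aut[OF a] cong: nn_integral_cong_simp)

lemma nn_integral_disc_rotation:
  assumes c: "norm c = 1" and F: "F \<in> borel_measurable disc_measure"
  shows "(\<integral>\<^sup>+z. F (c * z) \<partial>disc_measure) = (\<integral>\<^sup>+w. F w \<partial>disc_measure)"
proof -
  have "univalent_self_map ((*) c)"
    using c by (auto simp: univalent_self_map_def disc_self_map_def inj_on_def norm_mult
        intro!: holomorphic_intros)
  moreover have "(*) c ` unit_disc = unit_disc"
    using c by (auto simp: norm_mult norm_divide intro!: image_eqI[where x = "_ / c"])
  ultimately show ?thesis
    using nn_integral_disc_substitution[of "(*) c" F] F c by (simp cong: nn_integral_cong_simp)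
qed

lemma nn_integral_circle_means:
  assumes h: "h \<in> borel_measurable disc_measure" and w [measurable]: "w \<in> borel_measurable borel"
  shows "(\<integral>\<^sup>+v. (\<integral>\<^sup>+t\<in>{0..2*pi}. h (cis t * v) \<partial>lborel) * w (norm v) \<partial>disc_measure)
    = ennreal (2 * pi) * (\<integral>\<^sup>+v. h v * w (norm v) \<partial>disc_measure)"
proof -
  interpret pair_sigma_finite disc_measure lborel ..
  define F where "F = (\<lambda>v t. (h (cis t * v) * w (norm v)) * indicator {0..2*pi} t)"
  have [measurable]: "cis \<in> borel_measurable borel"
    by (intro borel_measurable_continuous_onI continuous_intros)
  have h_rotated [measurable]:
    "(\<lambda>(v, t). h (cis t * v)) \<in> borel_measurable (disc_measure \<Otimes>\<^sub>M lborel)"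
    unfolding case_prod_unfold
    by (rule measurable_compose[OF measurable_disc_measureI h])
      (measurable, simp add: space_pair_measure norm_mult mem_Times_iff)
  have "(\<integral>\<^sup>+v. (\<integral>\<^sup>+t\<in>{0..2*pi}. h (cis t * v) \<partial>lborel) * w (norm v) \<partial>disc_measure)
      = (\<integral>\<^sup>+v. (\<integral>\<^sup>+t. F v t \<partial>lborel) \<partial>disc_measure)"
    unfolding F_def using measurable_compose[OF measurable_Pair1' h_rotated]
    by (intro nn_integral_cong, subst nn_integral_multc[symmetric]) (auto simp: mult_ac)
  also have "\<dots> = (\<integral>\<^sup>+t. (\<integral>\<^sup>+v. F v t \<partial>disc_measure) \<partial>lborel)"
    unfolding F_def by (rule Fubini'[symmetric]) measurable
  also have "\<dots> = (\<integral>\<^sup>+t\<in>{0..2*pi}. (\<integral>\<^sup>+v. h v * w (norm v) \<partial>disc_measure) \<partial>lborel)"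
  proof (rule nn_integral_cong)
    fix t :: real
    have "(\<integral>\<^sup>+v. h (cis t * v) * w (norm (cis t * v)) \<partial>disc_measure)
        = (\<integral>\<^sup>+v. h v * w (norm v) \<partial>disc_measure)"
      using h by (intro nn_integral_disc_rotation[of "cis t" "\<lambda>v. h v * w (norm v)"]) auto
    then show "(\<integral>\<^sup>+v. F v t \<partial>disc_measure)
        = (\<integral>\<^sup>+v. h v * w (norm v) \<partial>disc_measure) * indicator {0..2*pi} t"
      by (simp add: F_def norm_mult indicator_def)
  qed
  also have "\<dots> = ennreal (2 * pi) * (\<integral>\<^sup>+v. h v * w (norm v) \<partial>disc_measure)"
    by (simp add: nn_integral_cmult_indicator mult.commute[of _ "indicator _ _"] nn_integral_multc)
  finally show ?thesis .
qed

lemma emeasure_disc_measure_norm_sq_greater: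
  "emeasure disc_measure {z \<in> unit_disc. x < (norm z)\<^sup>2} = emeasure lborel ({0..1} \<inter> {x<..})"
proof -
  consider (negative) "x < 0" | (inside) "0 \<le> x" "x < 1" | (outside) "1 \<le> x"
    by linarith
  then show ?thesis
  proof cases
    case negative
    then have "{z \<in> unit_disc. x < (norm z)\<^sup>2} = unit_disc" "{0..1} \<inter> {x<..} = {0..1}"
      by (auto intro: less_le_trans)
    then show ?thesis
      by simp
  next
    case inside
    have "x < (norm z)\<^sup>2 \<longleftrightarrow> \<not> norm z \<le> sqrt x" for z :: complex
      unfolding not_le real_sqrt_less_iff[of x, symmetric] by simp
    then have "{z \<in> unit_disc. x < (norm z)\<^sup>2} = unit_disc - cball 0 (sqrt x)"
      by (simp only: set_eq_iff mem_Collect_eq Diff_iff mem_cball_0 simp_thms)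
    moreover have "sqrt x < 1"
      using inside by simp
    then have sub: "cball 0 (sqrt x) \<subseteq> unit_disc"
      by (metis cball_subset_ball_iff dist_self add_0)
    moreover have "cball 0 (sqrt x) \<in> sets disc_measure" "unit_disc \<in> sets disc_measure"
      using sub by (auto simp: sets_disc_measure sets_restrict_space image_iff)
    moreover have "emeasure disc_measure (cball 0 (sqrt x)) = ennreal x"
      using inside sub
      by (simp add: emeasure_disc_measure emeasure_cball unit_ball_vol_2 flip: ennreal_mult)
    moreover have "{0..1} \<inter> {x<..} = {x<..1}"
      using inside by auto
    ultimately show ?thesis
      using inside by (simp add: emeasure_Diff ennreal_minus flip: ennreal_1)
  next
    case outside
    have "\<not> x < (norm z)\<^sup>2" if "norm z < 1" for z :: complex
      using conf_radius_pos[OF that] outside by (simp add: conf_radius_def)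
    then have "{z \<in> unit_disc. x < (norm z)\<^sup>2} = {}" "{0..1} \<inter> {x<..} = {}"
      using outside by auto
    then show ?thesis
      by (metis emeasure_empty)
  qed
qed

lemma nn_integral_disc_radial:
  assumes [measurable]: "w \<in> borel_measurable borel"
  shows "(\<integral>\<^sup>+z. w ((norm z)\<^sup>2) \<partial>disc_measure) = (\<integral>\<^sup>+t\<in>{0..1}. w t \<partial>lborel)"
proof -
  have "distr disc_measure borel (\<lambda>z. (norm z)\<^sup>2) = density lborel (indicator {0..1})"
  proof (rule measure_eqI_lessThan)
    fix x :: real
    have "emeasure (distr disc_measure borel (\<lambda>z. (norm z)\<^sup>2)) {x<..}
        = emeasure disc_measure {z \<in> unit_disc. x < (norm z)\<^sup>2}"
      by (subst emeasure_distr) (auto intro!: arg_cong[where f = "emeasure disc_measure"])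
    also have "\<dots> = emeasure (density lborel (indicator {0..1})) {x<..}"
      unfolding emeasure_disc_measure_norm_sq_greater
      by (simp add: emeasure_density flip: indicator_inter_arith)
    finally show "emeasure (distr disc_measure borel (\<lambda>z. (norm z)\<^sup>2)) {x<..}
        = emeasure (density lborel (indicator {0..1})) {x<..}" .
    show "emeasure (distr disc_measure borel (\<lambda>z. (norm z)\<^sup>2)) {x<..} < \<infinity>"
      by (simp add: emeasure_distr disc.emeasure_finite less_top[symmetric])
  qed simp_all
  then have "(\<integral>\<^sup>+t. w t \<partial>distr disc_measure borel (\<lambda>z. (norm z)\<^sup>2))
      = (\<integral>\<^sup>+t. w t \<partial>density lborel (indicator {0..1}))"
    by simp
  then show ?thesis
    by (simp add: nn_integral_distr nn_integral_density mult.commute)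
qed

section \<open>Mean values over circles\<close>

lemma circle_mean_holomorphic:
  assumes F: "F holomorphic_on unit_disc" and v: "norm v < 1"
  shows "((\<lambda>t. F (cis t * v)) has_integral 2 * of_real pi * F 0) {0..2*pi}"
proof -
  have "norm (z * v) < 1" if "norm z \<le> 1" for z
    using v that mult_mono[of "norm z" 1 "norm v" "norm v"] by (simp add: norm_mult)
  then have "(F \<circ> (\<lambda>z. z * v)) holomorphic_on cball 0 1"
    by (intro holomorphic_on_compose_gen[OF _ F]) (auto intro!: holomorphic_intros)
  then have "((\<lambda>z. F (z * v) / z) has_contour_integral 2 * of_real pi * \<i> * F 0)
      (circlepath 0 1)"
    using Cauchy_integral_circlepath_simple[of "F \<circ> (\<lambda>z. z * v)" 0 1 0] by (simp add: comp_def)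
  then have "((\<lambda>t. F (cis t * v) / cis t * \<i> * cis t) has_integral 2 * of_real pi * \<i> * F 0)
      {0..2*pi}"
    unfolding circlepath_def by (subst (asm) has_contour_integral_part_circlepath_iff) auto
  from has_integral_mult_right[OF this, of "-\<i>"] show ?thesis
    by (simp add: algebra_simps)
qed

lemma nn_integral_radial_Re:
  assumes F: "F holomorphic_on unit_disc" and pos: "\<And>z. norm z < 1 \<Longrightarrow> 0 \<le> Re (F z)"
    and w: "w \<in> borel_measurable borel"
  shows "(\<integral>\<^sup>+v. ennreal (Re (F v)) * w (norm v) \<partial>disc_measure)
    = ennreal (Re (F 0)) * (\<integral>\<^sup>+v. w (norm v) \<partial>disc_measure)"
proof -
  note [measurable] = w borel_measurable_disc_holomorphic[OF F]
  have mean: "(\<integral>\<^sup>+t\<in>{0..2*pi}. ennreal (Re (F (cis t * v))) \<partial>lborel) = ennreal (2 * pi * Re (F 0))"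
    if v: "norm v < 1" for v
    using has_integral_Re[OF circle_mean_holomorphic[OF F v]]
    by (intro nn_integral_has_integral_lebesgue') (auto intro!: pos simp: norm_mult v)
  have "ennreal (2 * pi) * (\<integral>\<^sup>+v. ennreal (Re (F v)) * w (norm v) \<partial>disc_measure)
      = (\<integral>\<^sup>+v. ennreal (2 * pi * Re (F 0)) * w (norm v) \<partial>disc_measure)"
    by (subst nn_integral_circle_means[symmetric]) (auto intro!: nn_integral_cong simp: mean)
  also have "\<dots> = ennreal (2 * pi) * (ennreal (Re (F 0)) * (\<integral>\<^sup>+v. w (norm v) \<partial>disc_measure))"
    by (simp add: nn_integral_cmult ennreal_mult' mult.assoc)
  finally show ?thesis
    by (simp add: ennreal_mult_cancel_left)
qed

lemma nn_integral_radial_ge_Re: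
  assumes F: "F holomorphic_on unit_disc" and h: "continuous_on unit_disc h"
    and Re_le: "\<And>z. norm z < 1 \<Longrightarrow> Re (F z) \<le> h z" and pos: "\<And>z. norm z < 1 \<Longrightarrow> 0 \<le> h z"
    and w: "w \<in> borel_measurable borel"
  shows "ennreal (Re (F 0)) * (\<integral>\<^sup>+v. w (norm v) \<partial>disc_measure)
    \<le> (\<integral>\<^sup>+v. ennreal (h v) * w (norm v) \<partial>disc_measure)"
proof -
  note [measurable] = w
  have [measurable]: "h \<in> borel_measurable disc_measure"
    unfolding measurable_cong_sets[OF sets_disc_measure refl]
    using h by (rule borel_measurable_continuous_on_restrict)
  have mean: "ennreal (2 * pi * Re (F 0)) \<le> (\<integral>\<^sup>+t\<in>{0..2*pi}. ennreal (h (cis t * v)) \<partial>lborel)"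
    if v: "norm v < 1" for v
  proof -
    have in_disc: "norm (cis t * v) < 1" for t
      using v by (simp add: norm_mult)
    have "continuous_on {0..2*pi} (\<lambda>t. h (cis t * v))"
      using in_disc by (intro continuous_on_compose2[OF h] continuous_intros) auto
    then have h_integral: "((\<lambda>t. h (cis t * v)) has_integral integral {0..2*pi} (\<lambda>t. h (cis t * v)))
        {0..2*pi}"
      by (intro integrable_integral integrable_continuous_real)
    then have "2 * pi * Re (F 0) \<le> integral {0..2*pi} (\<lambda>t. h (cis t * v))"
      using has_integral_le[OF has_integral_Re[OF circle_mean_holomorphic[OF F v]] h_integral
          Re_le[OF in_disc]] by simp
    also have "ennreal \<dots> = (\<integral>\<^sup>+t\<in>{0..2*pi}. ennreal (h (cis t * v)) \<partial>lborel)"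
      using pos[OF in_disc] h_integral by (rule nn_integral_has_integral_lebesgue'[symmetric])
    finally show ?thesis
      by (simp add: ennreal_leI)
  qed
  have "ennreal (2 * pi) * (ennreal (Re (F 0)) * (\<integral>\<^sup>+v. w (norm v) \<partial>disc_measure))
      = (\<integral>\<^sup>+v. ennreal (2 * pi * Re (F 0)) * w (norm v) \<partial>disc_measure)"
    by (simp add: nn_integral_cmult ennreal_mult' mult.assoc)
  also have "\<dots> \<le> (\<integral>\<^sup>+v. (\<integral>\<^sup>+t\<in>{0..2*pi}. ennreal (h (cis t * v)) \<partial>lborel) * w (norm v)
      \<partial>disc_measure)"
    by (intro nn_integral_mono mult_right_mono mean) auto
  also have "\<dots> = ennreal (2 * pi) * (\<integral>\<^sup>+v. ennreal (h v) * w (norm v) \<partial>disc_measure)"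
    by (rule nn_integral_circle_means) measurable
  finally show ?thesis
    by (simp add: ennreal_mult_le_mult_iff)
qed

lemma powr_tangent_le:
  fixes x y p :: real
  assumes "0 \<le> x" "0 \<le> y" "1 \<le> p"
  shows "p * y powr (p - 1) * x \<le> x powr p + (p - 1) * y powr p"
proof (cases "x = 0 \<or> y = 0")
  case True
  then show ?thesis using assms by auto
next
  case False
  then have "0 < x" "0 < y" using assms by auto
  then have "(x powr p) powr (1/p) * (y powr p) powr (1 - 1/p)
      \<le> 1/p * x powr p + (1 - 1/p) * y powr p"
    using assms by (intro Youngs_inequality_0) (auto simp: field_simps)
  moreover have "p * (1 - 1/p) = p - 1"
    using assms by (simp add: right_diff_distrib)
  ultimately have "x * y powr (p - 1) \<le> 1/p * x powr p + (1 - 1/p) * y powr p"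
    using assms by (simp add: powr_powr)
  then have "p * (x * y powr (p - 1)) \<le> p * (1/p * x powr p + (1 - 1/p) * y powr p)"
    using assms by (intro mult_left_mono) auto
  also have "\<dots> = x powr p + (p - 1) * y powr p"
    using assms by (simp add: field_simps)
  finally show ?thesis
    by (simp add: mult_ac)
qed

text \<open>
  \<open>\<bar>F\<bar> powr p\<close> lies above the real part of a holomorphic function that agrees with it at \<open>0\<close>.
\<close>

lemma nn_integral_radial_norm_powr_ge:
  assumes F: "F holomorphic_on unit_disc" and p: "1 \<le> p" and w: "w \<in> borel_measurable borel"
  shows "ennreal (norm (F 0) powr p) * (\<integral>\<^sup>+v. w (norm v) \<partial>disc_measure)
    \<le> (\<integral>\<^sup>+v. ennreal (norm (F v) powr p) * w (norm v) \<partial>disc_measure)"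
proof -
  define y where "y = norm (F 0)"
  define c where "c = cnj (sgn (F 0))"
  define L where "L = (\<lambda>z. of_real (p * y powr (p - 1)) * (c * F z) - of_real ((p - 1) * y powr p))"
  have c_rotates: "norm c \<le> 1" "c * F 0 = of_real y"
    by (auto simp: c_def y_def norm_sgn)
      (simp add: sgn_eq mult.commute complex_norm_square[symmetric] power2_eq_square)
  have L_holomorphic: "L holomorphic_on unit_disc"
    unfolding L_def using F by (intro holomorphic_intros)
  have norm_powr_continuous: "continuous_on unit_disc (\<lambda>z. norm (F z) powr p)"
    using F p by (intro continuous_on_powr' continuous_intros holomorphic_on_imp_continuous_on) auto
  have Re_L_le: "Re (L z) \<le> norm (F z) powr p" for z
  proof -
    have "Re (c * F z) \<le> norm (c * F z)"
      by (rule complex_Re_le_cmod)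
    also have "\<dots> \<le> norm (F z)"
      using c_rotates(1) by (simp add: norm_mult mult_left_le_one_le)
    finally have "p * y powr (p - 1) * Re (c * F z) \<le> p * y powr (p - 1) * norm (F z)"
      using p by (intro mult_left_mono) auto
    also have "\<dots> \<le> norm (F z) powr p + (p - 1) * y powr p"
      using p by (intro powr_tangent_le) (auto simp: y_def)
    finally show ?thesis
      by (simp add: L_def)
  qed
  have "y powr (p - 1) * y = y powr p"
    using p powr_mult_base[of y "p - 1"] by (simp add: y_def mult.commute)
  moreover have "L 0 = of_real (p * (y powr (p - 1) * y) - (p - 1) * y powr p)"
    by (simp add: L_def c_rotates(2))
  ultimately have "Re (L 0) = y powr p"
    by (simp add: algebra_simps)
  then show ?thesis
    using nn_integral_radial_ge_Re[OF L_holomorphic norm_powr_continuous Re_L_le _ w]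
    by (simp add: y_def)
qed

section \<open>A mean value estimate for the conformal radius\<close>

lemma nn_integral_disc_inverse_square:
  assumes "0 \<le> q" "q < 1"
  shows "(\<integral>\<^sup>+z. ennreal (1 / (1 - q * (norm z)\<^sup>2)\<^sup>2) \<partial>disc_measure) = ennreal (1 / (1 - q))"
proof -
  have denom_pos: "0 < 1 - q * t" if "t \<in> {0..1}" for t
    using that assms mult_left_le[of t q] by auto
  have "((\<lambda>t. t / (1 - q * t)) has_real_derivative 1 / (1 - q * t)\<^sup>2) (at t within {0..1})"
    if "t \<in> {0..1}" for t
    using denom_pos[OF that]
    by (auto intro!: derivative_eq_intros simp: power2_eq_square field_simps)
  then have "((\<lambda>t. 1 / (1 - q * t)\<^sup>2) has_integral 1 / (1 - q)) {0..1}"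
    using fundamental_theorem_of_calculus[of 0 1 "\<lambda>t. t / (1 - q * t)"]
    by (simp add: has_real_derivative_iff_has_vector_derivative)
  then have "(\<integral>\<^sup>+t\<in>{0..1}. ennreal (1 / (1 - q * t)\<^sup>2) \<partial>lborel) = ennreal (1 / (1 - q))"
    by (intro nn_integral_has_integral_lebesgue') auto
  then show ?thesis
    by (subst nn_integral_disc_radial) auto
qed

lemma nn_integral_conf_radius_cube_le:
  assumes G: "disc_self_map G"
  shows "(\<integral>\<^sup>+z. ennreal (conf_radius (G z) ^ 3) \<partial>disc_measure)
    \<le> ennreal (16 * (conf_radius (G 0))\<^sup>2)"
proof -
  define u c where "u = G 0" and "c = conf_radius u"
  define \<Psi> where "\<Psi> = disc_aut u \<circ> G"
  define P where "P = herglotz_kernel u \<circ> \<Psi>"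
  define w where "w = (\<lambda>r::real. ennreal (1 / (1 - (norm u)\<^sup>2 * r\<^sup>2)\<^sup>2))"
  have u: "norm u < 1"
    using disc_self_map_norm_less_one[OF G, of 0] by (simp add: u_def)
  then have c_pos: "0 < c"
    unfolding c_def by (rule conf_radius_pos)
  have \<Psi>: "disc_self_map \<Psi>"
    unfolding \<Psi>_def using u G by (rule disc_self_map_disc_aut_comp)
  note \<Psi>_less_one = disc_self_map_norm_less_one[OF \<Psi>]
  have P_holomorphic: "P holomorphic_on unit_disc"
    unfolding P_def using holomorphic_on_herglotz_kernel[OF u] \<Psi>
    by (rule holomorphic_on_comp_disc_self_map)
  have P_nonneg: "0 \<le> Re (P z)" if "norm z < 1" for z
    using Re_herglotz_kernel_pos[OF u \<Psi>_less_one[OF that]] by (simp add: P_def)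
  have "conf_radius (G z) ^ 3 \<le> 16 * c ^ 3 * (Re (P z) * (1 / (1 - (norm u)\<^sup>2 * (norm z)\<^sup>2)\<^sup>2))"
    if z: "norm z < 1" for z
  proof -
    have "norm (\<Psi> z) \<le> norm z"
      using Schwarz_Pick[OF G, of 0 z] z by (simp add: \<Psi>_def u_def disc_aut_zero_left)
    moreover have "G z = disc_aut u (\<Psi> z)"
      using u disc_self_map_norm_less_one[OF G z] by (simp add: \<Psi>_def disc_aut_disc_aut)
    ultimately show ?thesis
      using conf_radius_disc_aut_cube_le[OF u \<Psi>_less_one[OF z] _ z] by (simp add: P_def c_def)
  qed
  then have "(\<integral>\<^sup>+z. ennreal (conf_radius (G z) ^ 3) \<partial>disc_measure)
      \<le> (\<integral>\<^sup>+z. ennreal (16 * c ^ 3) * (ennreal (Re (P z)) * w (norm z)) \<partial>disc_measure)"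
    using c_pos P_nonneg
    by (intro nn_integral_mono) (auto simp: w_def ennreal_leI simp flip: ennreal_mult)
  also have "\<dots> = ennreal (16 * c ^ 3) * (\<integral>\<^sup>+z. ennreal (Re (P z)) * w (norm z) \<partial>disc_measure)"
    using borel_measurable_disc_holomorphic(1)[OF P_holomorphic]
    by (intro nn_integral_cmult) (simp add: w_def)
  also have "\<dots> = ennreal (16 * c ^ 3) * (ennreal (Re (P 0)) * (\<integral>\<^sup>+z. w (norm z) \<partial>disc_measure))"
    using P_holomorphic P_nonneg by (subst nn_integral_radial_Re) (auto simp: w_def)
  also have "P 0 = 1"
    by (simp add: P_def \<Psi>_def u_def disc_aut_self herglotz_kernel_def)
  also have "(\<integral>\<^sup>+z. w (norm z) \<partial>disc_measure) = ennreal (1 / c)"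
    unfolding w_def c_def conf_radius_def using u
    by (intro nn_integral_disc_inverse_square) (auto simp: abs_square_less_1)
  finally show ?thesis
    using c_pos by (simp add: power2_eq_square power3_eq_cube c_def u_def flip: ennreal_mult)
qed

lemma nn_integral_conf_radius_cube_disc_aut_le:
  assumes H: "disc_self_map H" and a: "norm a < 1"
  shows "(\<integral>\<^sup>+z. ennreal (conf_radius (H z) ^ 3 * (norm (deriv (disc_aut a) z))\<^sup>2) \<partial>disc_measure)
    \<le> ennreal (16 * (conf_radius (H a))\<^sup>2)"
proof -
  define G where "G = H \<circ> disc_aut a"
  have G: "disc_self_map G"
    unfolding G_def using H a by (rule disc_self_map_comp_disc_aut)
  note [measurable] = borel_measurable_disc_self_map[OF G]
  have "(\<integral>\<^sup>+z. ennreal (conf_radius (H z) ^ 3 * (norm (deriv (disc_aut a) z))\<^sup>2) \<partial>disc_measure)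
      = (\<integral>\<^sup>+z. ennreal (conf_radius (G (disc_aut a z)) ^ 3)
        * ennreal ((norm (deriv (disc_aut a) z))\<^sup>2) \<partial>disc_measure)"
    using a by (intro nn_integral_cong) (simp add: G_def disc_aut_disc_aut ennreal_mult'')
  also have "\<dots> = (\<integral>\<^sup>+z. ennreal (conf_radius (G z) ^ 3) \<partial>disc_measure)"
    using a by (intro nn_integral_disc_aut_substitution) measurable
  also have "\<dots> \<le> ennreal (16 * (conf_radius (G 0))\<^sup>2)"
    using G by (rule nn_integral_conf_radius_cube_le)
  finally show ?thesis
    by (simp add: G_def disc_aut_zero_right)
qed

section \<open>The kernel of the composition operator\<close>

definition bmoa_density :: "real \<Rightarrow> (complex \<Rightarrow> complex) \<Rightarrow> complex \<Rightarrow> real" where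
  "bmoa_density p f z = norm (deriv f z) powr p * conf_radius z powr (p - 2)"

lemma bmoa_density_nonneg: "0 \<le> bmoa_density p f z"
  by (simp add: bmoa_density_def)

lemma borel_measurable_bmoa_density:
  "f holomorphic_on unit_disc \<Longrightarrow> bmoa_density p f \<in> borel_measurable disc_measure"
  using borel_measurable_disc_holomorphic[of f] unfolding bmoa_density_def by measurable

lemma bmoa_integral_eq:
  "bmoa_integral p f a
    = (\<integral>\<^sup>+z. ennreal (bmoa_density p f z * conf_radius (disc_aut a z)) \<partial>disc_measure)"
  by (simp add: bmoa_integral_def bmoa_density_def conf_radius_def)

lemma bmoa_density_comp_disc_aut:
  assumes f: "f holomorphic_on unit_disc" and w: "norm w < 1" and v: "norm v < 1"
  shows "bmoa_density p (f \<circ> disc_aut w) v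
    = bmoa_density p f (disc_aut w v) * (norm (deriv (disc_aut w) v))\<^sup>2"
proof -
  define d where "d = norm (deriv (disc_aut w) v)"
  have d_pos: "0 < d"
    unfolding d_def using w v by (rule norm_deriv_disc_aut_pos)
  have "conf_radius (disc_aut w v) = d * conf_radius v"
    using norm_deriv_disc_aut_mult_conf_radius[OF w v] by (simp add: d_def)
  moreover have "norm (deriv (f \<circ> disc_aut w) v) = norm (deriv f (disc_aut w v)) * d"
    using norm_deriv_comp_disc_self_map[OF f disc_self_map_disc_aut[OF w] v] by (simp add: d_def)
  moreover have "d powr p = d powr (p - 2) * d\<^sup>2"
    using d_pos by (simp add: powr_diff)
  ultimately show ?thesis
    by (simp add: bmoa_density_def powr_mult mult_ac flip: d_def)
qed

lemma nn_integral_conf_radius_powr: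
  assumes "0 < \<alpha>"
  shows "(\<integral>\<^sup>+v. ennreal (conf_radius v powr \<alpha>) \<partial>disc_measure) = ennreal (1 / (\<alpha> + 1))"
proof -
  define F where "F = (\<lambda>t. - ((1 - t) powr (\<alpha> + 1) / (\<alpha> + 1)))"
  have "(F has_real_derivative (1 - t) powr \<alpha>) (at t)" if "t < 1" for t
    unfolding F_def using that assms by (auto intro!: derivative_eq_intros)
  moreover have "continuous_on {0..1} F"
    unfolding F_def using assms by (intro continuous_intros continuous_on_powr') auto
  ultimately have "((\<lambda>t. (1 - t) powr \<alpha>) has_integral F 1 - F 0) {0..1}"
    by (intro fundamental_theorem_of_calculus_interior)
      (auto simp: has_real_derivative_iff_has_vector_derivative)
  then have "((\<lambda>t. (1 - t) powr \<alpha>) has_integral 1 / (\<alpha> + 1)) {0..1}"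
    using assms by (simp add: F_def)
  then have "(\<integral>\<^sup>+t\<in>{0..1}. ennreal ((1 - t) powr \<alpha>) \<partial>lborel) = ennreal (1 / (\<alpha> + 1))"
    by (intro nn_integral_has_integral_lebesgue') auto
  then show ?thesis
    unfolding conf_radius_def by (subst nn_integral_disc_radial) auto
qed

lemma norm_deriv_powr_mult_conf_radius_powr:
  assumes "norm v < 1"
  shows "norm (deriv f v) powr p * conf_radius v powr (p + 1)
    = bmoa_density p f v * conf_radius v ^ 3"
proof -
  have "conf_radius v powr (p + 1) = conf_radius v powr (p - 2) * conf_radius v ^ 3"
    using conf_radius_pos[OF assms] powr_add[of "conf_radius v" "p - 2" 3]
    by (simp add: powr_numeral add.commute)
  then show ?thesis
    by (simp add: bmoa_density_def)
qed

lemma norm_deriv_powr_le_nn_integral_bmoa_density: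
  assumes f: "f holomorphic_on unit_disc" and w: "norm w < 1" and p: "1 \<le> p"
  shows "ennreal ((norm (deriv f w) * conf_radius w) powr p) \<le> ennreal (p + 2)
    * (\<integral>\<^sup>+u. ennreal (bmoa_density p f u * conf_radius (disc_aut w u) ^ 3) \<partial>disc_measure)"
proof -
  define F where "F = f \<circ> disc_aut w"
  define W where "W = (\<lambda>r::real. ennreal ((1 - r\<^sup>2) powr (p + 1)))"
  define h where "h = (\<lambda>u. bmoa_density p f u * conf_radius (disc_aut w u) ^ 3)"
  have F: "F holomorphic_on unit_disc"
    unfolding F_def using f disc_self_map_disc_aut[OF w] by (rule holomorphic_on_comp_disc_self_map)
  note [measurable] = borel_measurable_bmoa_density[OF f]
  have deriv_F_0: "norm (deriv F 0) = norm (deriv f w) * conf_radius w"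
    using norm_deriv_comp_disc_self_map[OF f disc_self_map_disc_aut[OF w], of 0]
      norm_deriv_disc_aut[OF w, of 0] by (simp add: F_def disc_aut_zero_right)
  have "(\<integral>\<^sup>+v. W (norm v) \<partial>disc_measure) = ennreal (1 / (p + 2))"
    using nn_integral_conf_radius_powr[of "p + 1"] p by (simp add: W_def conf_radius_def add.assoc)
  then have "ennreal (norm (deriv F 0) powr p) * ennreal (1 / (p + 2))
      \<le> (\<integral>\<^sup>+v. ennreal (norm (deriv F v) powr p) * W (norm v) \<partial>disc_measure)"
    using nn_integral_radial_norm_powr_ge[of "deriv F" p W] F p
    by (simp add: W_def holomorphic_deriv)
  also have "\<dots> = (\<integral>\<^sup>+v. ennreal (h (disc_aut w v)) * ennreal ((norm (deriv (disc_aut w) v))\<^sup>2)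
      \<partial>disc_measure)"
  proof (rule nn_integral_cong)
    fix v assume "v \<in> space disc_measure"
    then have v: "norm v < 1" by simp
    have "norm (deriv F v) powr p * conf_radius v powr (p + 1)
        = h (disc_aut w v) * (norm (deriv (disc_aut w) v))\<^sup>2"
      unfolding norm_deriv_powr_mult_conf_radius_powr[OF v]
      by (simp add: F_def h_def bmoa_density_comp_disc_aut[OF f w v] disc_aut_disc_aut[OF w v])
    then show "ennreal (norm (deriv F v) powr p) * W (norm v)
        = ennreal (h (disc_aut w v)) * ennreal ((norm (deriv (disc_aut w) v))\<^sup>2)"
      by (simp add: W_def flip: conf_radius_def ennreal_mult ennreal_mult'')
  qed
  also have "\<dots> = (\<integral>\<^sup>+u. ennreal (h u) \<partial>disc_measure)"
    using w by (intro nn_integral_disc_aut_substitution[where F = "\<lambda>u. ennreal (h u)"])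
      (simp_all add: h_def)
  finally have "ennreal (p + 2) * (ennreal (norm (deriv F 0) powr p) * ennreal (1 / (p + 2)))
      \<le> ennreal (p + 2) * (\<integral>\<^sup>+u. ennreal (h u) \<partial>disc_measure)"
    by (rule mult_left_mono) simp
  then show ?thesis
    using p by (simp add: h_def del: ennreal_plus flip: ennreal_mult deriv_F_0)
qed

text \<open>
  For \<open>H = disc_aut u \<circ> \<psi>\<close> this is the weight with which \<open>bmoa_density p f u\<close> contributes to the
  integrand of \<open>bmoa_integral p (f \<circ> \<psi>) a\<close> at \<open>z\<close>.
\<close>

definition comp_kernel :: "real \<Rightarrow> (complex \<Rightarrow> complex) \<Rightarrow> complex \<Rightarrow> complex \<Rightarrow> real" where
  "comp_kernel p H a z = hyp_deriv H z powr p * conf_radius z powr (p - 2)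
     * conf_radius (disc_aut a z) * conf_radius (H z) ^ 3"

definition comp_kernel_integral :: "real \<Rightarrow> (complex \<Rightarrow> complex) \<Rightarrow> complex \<Rightarrow> ennreal" where
  "comp_kernel_integral p H a = (\<integral>\<^sup>+z. ennreal (comp_kernel p H a z) \<partial>disc_measure)"

lemma comp_kernel_disc_aut_comp:
  assumes "disc_self_map \<psi>" "norm u < 1" "norm z < 1"
  shows "comp_kernel p (disc_aut u \<circ> \<psi>) a z = hyp_deriv \<psi> z powr p * conf_radius z powr (p - 2)
    * conf_radius (disc_aut a z) * conf_radius (disc_aut u (\<psi> z)) ^ 3"
  by (simp add: comp_kernel_def hyp_deriv_disc_aut_comp[OF assms])

lemma borel_measurable_comp_kernel_disc_aut_comp:
  assumes \<psi>: "disc_self_map \<psi>"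
  shows "(\<lambda>(u, z). ennreal (comp_kernel p (disc_aut u \<circ> \<psi>) a z))
    \<in> borel_measurable (disc_measure \<Otimes>\<^sub>M disc_measure)"
proof -
  note [measurable] = borel_measurable_disc_self_map[OF \<psi>]
  have "(\<lambda>(u, z). ennreal (hyp_deriv \<psi> z powr p * conf_radius z powr (p - 2)
      * conf_radius (disc_aut a z) * conf_radius (disc_aut u (\<psi> z)) ^ 3))
    \<in> borel_measurable (disc_measure \<Otimes>\<^sub>M disc_measure)"
    unfolding hyp_deriv_def by measurable
  then show ?thesis
    by (rule measurable_cong[THEN iffD1, rotated])
      (auto simp: space_pair_measure comp_kernel_disc_aut_comp[OF \<psi>])
qed

lemma borel_measurable_comp_kernel_integral_disc_aut_comp:
  assumes "disc_self_map \<psi>"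
  shows "(\<lambda>u. comp_kernel_integral p (disc_aut u \<circ> \<psi>) a) \<in> borel_measurable disc_measure"
  unfolding comp_kernel_integral_def using borel_measurable_comp_kernel_disc_aut_comp[OF assms]
  by (rule disc.borel_measurable_nn_integral)

lemma bmoa_density_comp_le:
  assumes f: "f holomorphic_on unit_disc" and \<psi>: "disc_self_map \<psi>"
    and a: "norm a < 1" and z: "norm z < 1" and p: "1 \<le> p"
  shows "ennreal (bmoa_density p (f \<circ> \<psi>) z * conf_radius (disc_aut a z)) \<le> ennreal (p + 2)
    * (\<integral>\<^sup>+u. ennreal (bmoa_density p f u) * ennreal (comp_kernel p (disc_aut u \<circ> \<psi>) a z)
      \<partial>disc_measure)"
proof -
  define V where
    "V = hyp_deriv \<psi> z powr p * conf_radius z powr (p - 2) * conf_radius (disc_aut a z)"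
  define h where "h = (\<lambda>u. bmoa_density p f u * conf_radius (disc_aut (\<psi> z) u) ^ 3)"
  note [measurable] = borel_measurable_bmoa_density[OF f]
  note \<psi>z = disc_self_map_norm_less_one[OF \<psi> z]
  have V_nonneg: "0 \<le> V"
    using conf_radius_disc_aut_pos[OF a z] by (simp add: V_def)
  have "norm (deriv (f \<circ> \<psi>) z) = norm (deriv f (\<psi> z)) * conf_radius (\<psi> z) * hyp_deriv \<psi> z"
    using conf_radius_pos[OF \<psi>z] norm_deriv_comp_disc_self_map[OF f \<psi> z]
    by (simp add: hyp_deriv_def)
  then have "bmoa_density p (f \<circ> \<psi>) z * conf_radius (disc_aut a z)
      = (norm (deriv f (\<psi> z)) * conf_radius (\<psi> z)) powr p * V"
    by (simp add: bmoa_density_def V_def powr_mult mult_ac)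
  then have "ennreal (bmoa_density p (f \<circ> \<psi>) z * conf_radius (disc_aut a z))
      = ennreal ((norm (deriv f (\<psi> z)) * conf_radius (\<psi> z)) powr p) * ennreal V"
    using V_nonneg by (simp add: ennreal_mult)
  also have "\<dots> \<le> ennreal (p + 2) * (\<integral>\<^sup>+u. ennreal (h u) \<partial>disc_measure) * ennreal V"
    unfolding h_def using f \<psi>z p
    by (intro mult_right_mono norm_deriv_powr_le_nn_integral_bmoa_density) auto
  also have "\<dots> = ennreal (p + 2) * (\<integral>\<^sup>+u. ennreal (h u) * ennreal V \<partial>disc_measure)"
    by (simp add: h_def nn_integral_multc mult.assoc)
  also have "(\<integral>\<^sup>+u. ennreal (h u) * ennreal V \<partial>disc_measure)
      = (\<integral>\<^sup>+u. ennreal (bmoa_density p f u) * ennreal (comp_kernel p (disc_aut u \<circ> \<psi>) a z)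
        \<partial>disc_measure)"
  proof (rule nn_integral_cong)
    fix u assume "u \<in> space disc_measure"
    then have u: "norm u < 1" by simp
    then have "comp_kernel p (disc_aut u \<circ> \<psi>) a z = conf_radius (disc_aut (\<psi> z) u) ^ 3 * V"
      using z by (simp add: comp_kernel_disc_aut_comp[OF \<psi>] V_def conf_radius_disc_aut_commute)
    then show "ennreal (h u) * ennreal V
        = ennreal (bmoa_density p f u) * ennreal (comp_kernel p (disc_aut u \<circ> \<psi>) a z)"
      using V_nonneg conf_radius_disc_aut_pos[OF \<psi>z u] bmoa_density_nonneg[of p f u]
      by (simp add: h_def mult.assoc flip: ennreal_mult)
  qed
  finally show ?thesis .
qed

lemma bmoa_integral_comp_le_comp_kernel_integral:
  assumes f: "f holomorphic_on unit_disc" and \<psi>: "disc_self_map \<psi>"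
    and a: "norm a < 1" and p: "1 \<le> p"
  shows "bmoa_integral p (f \<circ> \<psi>) a \<le> ennreal (p + 2)
    * (\<integral>\<^sup>+u. ennreal (bmoa_density p f u) * comp_kernel_integral p (disc_aut u \<circ> \<psi>) a
      \<partial>disc_measure)"
proof -
  interpret pair_sigma_finite disc_measure disc_measure ..
  define E k where "E = (\<lambda>u. ennreal (bmoa_density p f u))"
    and "k = (\<lambda>u z. ennreal (comp_kernel p (disc_aut u \<circ> \<psi>) a z))"
  have [measurable]: "(\<lambda>(u, z). k u z) \<in> borel_measurable (disc_measure \<Otimes>\<^sub>M disc_measure)"
    unfolding k_def using \<psi> by (rule borel_measurable_comp_kernel_disc_aut_comp)
  have [measurable]: "E \<in> borel_measurable disc_measure"
    using borel_measurable_bmoa_density[OF f] by (simp add: E_def)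
  have "bmoa_integral p (f \<circ> \<psi>) a
      \<le> (\<integral>\<^sup>+z. ennreal (p + 2) * (\<integral>\<^sup>+u. E u * k u z \<partial>disc_measure) \<partial>disc_measure)"
    unfolding bmoa_integral_eq E_def k_def using f \<psi> a p
    by (intro nn_integral_mono bmoa_density_comp_le) auto
  also have "\<dots> = ennreal (p + 2) * (\<integral>\<^sup>+z. (\<integral>\<^sup>+u. E u * k u z \<partial>disc_measure) \<partial>disc_measure)"
    by (rule nn_integral_cmult) measurable
  also have "(\<integral>\<^sup>+z. (\<integral>\<^sup>+u. E u * k u z \<partial>disc_measure) \<partial>disc_measure)
      = (\<integral>\<^sup>+u. (\<integral>\<^sup>+z. E u * k u z \<partial>disc_measure) \<partial>disc_measure)"
    by (rule Fubini') measurable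
  also have "\<dots> = (\<integral>\<^sup>+u. E u * (\<integral>\<^sup>+z. k u z \<partial>disc_measure) \<partial>disc_measure)"
    by (intro nn_integral_cong nn_integral_cmult) measurable
  finally show ?thesis
    unfolding E_def k_def comp_kernel_integral_def .
qed

lemma powr_mult_powr_le:
  fixes x y p :: real
  assumes "0 \<le> x" "0 \<le> y" "0 \<le> p" "p \<le> 2"
  shows "x powr p * y powr (2 - p) \<le> x\<^sup>2 + y\<^sup>2"
proof -
  define m where "m = max x y"
  have m_bounds: "0 \<le> m" "x \<le> m" "y \<le> m"
    using assms by (auto simp: m_def)
  have "x powr p * y powr (2 - p) \<le> m powr p * m powr (2 - p)"
    using assms m_bounds by (intro mult_mono powr_mono2) auto
  also have "\<dots> = m\<^sup>2"
    using m_bounds by (simp add: powr_numeral flip: powr_add)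
  also have "\<dots> \<le> x\<^sup>2 + y\<^sup>2"
    by (simp add: m_def max_def)
  finally show ?thesis .
qed

lemma conf_radius_powr_mult_disc_aut:
  assumes "norm a < 1" "norm z < 1"
  shows "conf_radius z powr (p - 2) * conf_radius (disc_aut a z)
    = conf_radius (disc_aut a z) powr (p - 1) * norm (deriv (disc_aut a) z) powr (2 - p)"
proof -
  define g s where "g = norm (deriv (disc_aut a) z)" and "s = conf_radius z"
  have g_pos: "0 < g" and s_pos: "0 < s"
    using norm_deriv_disc_aut_pos[OF assms] conf_radius_pos[OF assms(2)]
    by (simp_all add: g_def s_def)
  have "(g * s) powr (p - 1) * g powr (2 - p) = (g powr (p - 1) * g powr (2 - p)) * s powr (p - 1)"
    by (simp add: powr_mult mult_ac)
  also have "\<dots> = s powr (p - 2) * (g * s)"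
    using g_pos s_pos powr_add[of s "p - 2" 1] by (simp flip: powr_add)
  finally show ?thesis
    using norm_deriv_disc_aut_mult_conf_radius[OF assms] by (simp add: g_def s_def)
qed

lemma comp_kernel_eq:
  assumes H: "disc_self_map H" and a: "norm a < 1" and z: "norm z < 1"
  shows "comp_kernel p H a z = norm (deriv H z) powr p
    * ((conf_radius (disc_aut a z) * conf_radius (H z)) powr (p - 1)
      * (norm (deriv (disc_aut a) z) * (conf_radius (H z))\<^sup>2) powr (2 - p))"
proof -
  define h where "h = conf_radius (H z)"
  have h_pos: "0 < h"
    unfolding h_def by (rule conf_radius_pos[OF disc_self_map_norm_less_one[OF H z]])
  have "h ^ 3 = h powr p * (h powr (p - 1) * (h\<^sup>2) powr (2 - p))"
    using h_pos by (simp add: powr_powr algebra_simps flip: powr_add powr_numeral)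
  moreover have "comp_kernel p H a z = (norm (deriv H z) / h) powr p
      * (conf_radius (disc_aut a z) powr (p - 1) * norm (deriv (disc_aut a) z) powr (2 - p))
      * h ^ 3"
    using conf_radius_powr_mult_disc_aut[OF a z, of p]
    by (simp add: comp_kernel_def hyp_deriv_def h_def mult.assoc)
  ultimately show ?thesis
    using h_pos by (simp add: powr_divide powr_mult mult_ac flip: h_def)
qed

lemma comp_kernel_le:
  assumes H: "disc_self_map H" and a: "norm a < 1" and z: "norm z < 1" and p: "1 \<le> p" "p \<le> 2"
  shows "comp_kernel p H a z \<le> 4 * conf_radius (H a) * (norm (deriv H z))\<^sup>2
    + 4 / conf_radius (H a) * (conf_radius (H z) ^ 3 * (norm (deriv (disc_aut a) z))\<^sup>2)"
proof -
  define c h x g r where "c = conf_radius (H a)" and "h = conf_radius (H z)"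
    and "x = norm (deriv H z)" and "g = norm (deriv (disc_aut a) z)"
    and "r = conf_radius (disc_aut a z)"
  have c_pos: "0 < c" and h_bounds: "0 < h" "h \<le> 1" and r_pos: "0 < r"
    using conf_radius_pos disc_self_map_norm_less_one[OF H] a z conf_radius_le_one
      conf_radius_disc_aut_pos by (auto simp: c_def h_def r_def)
  have "(r * h) powr (p - 1) \<le> (4 * c) powr (p - 1)"
    using conf_radius_comp_le[OF H a z] r_pos h_bounds p
    by (intro powr_mono2) (auto simp: r_def h_def c_def)
  also have "\<dots> \<le> 4 powr 1 * c powr (p - 1)"
    unfolding powr_mult using p by (intro mult_right_mono powr_mono) auto
  finally have "comp_kernel p H a z \<le> x powr p * (4 * c powr (p - 1) * (g * h\<^sup>2) powr (2 - p))"
    unfolding comp_kernel_eq[OF H a z] x_def[symmetric] g_def[symmetric] h_def[symmetric]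
      r_def[symmetric]
    by (intro mult_left_mono mult_right_mono) auto
  also have "\<dots> = 4 * c * (x powr p * (g * h\<^sup>2 / c) powr (2 - p))"
    using c_pos powr_add[of c "p - 1" "2 - p"] by (simp add: powr_divide field_simps)
  also have "\<dots> \<le> 4 * c * (x\<^sup>2 + (g * h\<^sup>2 / c)\<^sup>2)"
    using h_bounds c_pos p by (intro mult_left_mono powr_mult_powr_le) (auto simp: x_def g_def)
  also have "\<dots> = 4 * c * x\<^sup>2 + 4 / c * (h ^ 4 * g\<^sup>2)"
    using c_pos by (simp add: field_simps power2_eq_square power4_eq_xxxx)
  also have "\<dots> \<le> 4 * c * x\<^sup>2 + 4 / c * (h ^ 3 * g\<^sup>2)"
    using c_pos h_bounds
    by (intro add_left_mono mult_left_mono mult_right_mono power_decreasing) auto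
  finally show ?thesis
    by (simp add: c_def h_def x_def g_def)
qed

lemma comp_kernel_integral_le:
  assumes H: "univalent_self_map H" and a: "norm a < 1" and p: "1 \<le> p" "p \<le> 2"
  shows "comp_kernel_integral p H a \<le> ennreal (68 * conf_radius (H a))"
proof -
  define c where "c = conf_radius (H a)"
  define q where "q = (\<lambda>z. conf_radius (H z) ^ 3 * (norm (deriv (disc_aut a) z))\<^sup>2)"
  note self = univalent_self_mapD(1)[OF H]
  note less_one = disc_self_map_norm_less_one[OF self]
  have c_pos: "0 < c"
    unfolding c_def using less_one[OF a] by (rule conf_radius_pos)
  have q_nonneg: "0 \<le> q z" if "norm z < 1" for z
    using conf_radius_nonneg[OF less_one[OF that]] by (simp add: q_def)
  note [measurable] = borel_measurable_disc_self_map[OF self]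
    borel_measurable_disc_self_map[OF disc_self_map_disc_aut[OF a]]
  have "comp_kernel_integral p H a \<le> (\<integral>\<^sup>+z. ennreal (4 * c) * ennreal ((norm (deriv H z))\<^sup>2)
      + ennreal (4 / c) * ennreal (q z) \<partial>disc_measure)"
    unfolding comp_kernel_integral_def using comp_kernel_le[OF self a _ p] c_pos q_nonneg
    by (intro nn_integral_mono) (simp add: ennreal_leI c_def q_def flip: ennreal_mult ennreal_plus)
  also have "\<dots> = ennreal (4 * c) * (\<integral>\<^sup>+z. ennreal ((norm (deriv H z))\<^sup>2) \<partial>disc_measure)
       + ennreal (4 / c) * (\<integral>\<^sup>+z. ennreal (q z) \<partial>disc_measure)"
    by (simp add: q_def nn_integral_add nn_integral_cmult)
  also have "\<dots> \<le> ennreal (4 * c) * ennreal 1 + ennreal (4 / c) * ennreal (16 * c\<^sup>2)"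
    using nn_integral_norm_deriv_sq_le[OF H] nn_integral_conf_radius_cube_disc_aut_le[OF self a]
    by (intro add_mono mult_left_mono) (auto simp: q_def c_def)
  also have "\<dots> = ennreal (68 * c)"
    using c_pos by (simp add: power2_eq_square flip: ennreal_mult ennreal_plus)
  finally show ?thesis
    by (simp add: c_def)
qed

lemma bmoa_integral_comp_le:
  assumes f: "f holomorphic_on unit_disc" and \<psi>: "univalent_self_map \<psi>"
    and a: "norm a < 1" and p: "1 \<le> p" "p \<le> 2"
  shows "bmoa_integral p (f \<circ> \<psi>) a \<le> 272 * bmoa_integral p f (\<psi> a)"
proof -
  note self = univalent_self_mapD(1)[OF \<psi>]
  note \<psi>a = disc_self_map_norm_less_one[OF self a]
  note [measurable] = borel_measurable_bmoa_density[OF f]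
  have "bmoa_integral p (f \<circ> \<psi>) a \<le> ennreal (p + 2)
    * (\<integral>\<^sup>+u. ennreal (bmoa_density p f u) * comp_kernel_integral p (disc_aut u \<circ> \<psi>) a
      \<partial>disc_measure)"
    using f self a p(1) by (rule bmoa_integral_comp_le_comp_kernel_integral)
  also have "\<dots> \<le> 4
    * (\<integral>\<^sup>+u. 68 * ennreal (bmoa_density p f u * conf_radius (disc_aut (\<psi> a) u)) \<partial>disc_measure)"
  proof (rule mult_mono[OF _ nn_integral_mono])
    fix u assume "u \<in> space disc_measure"
    then have u: "norm u < 1" by simp
    have "comp_kernel_integral p (disc_aut u \<circ> \<psi>) a \<le> ennreal (68 * conf_radius (disc_aut (\<psi> a) u))"
      using comp_kernel_integral_le[OF univalent_self_map_disc_aut_comp[OF u \<psi>] a p]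
      by (simp add: conf_radius_disc_aut_commute)
    then have "ennreal (bmoa_density p f u) * comp_kernel_integral p (disc_aut u \<circ> \<psi>) a
        \<le> ennreal (bmoa_density p f u) * ennreal (68 * conf_radius (disc_aut (\<psi> a) u))"
      by (rule mult_left_mono) simp
    also have "\<dots> = 68 * ennreal (bmoa_density p f u * conf_radius (disc_aut (\<psi> a) u))"
      using conf_radius_disc_aut_pos[OF \<psi>a u] bmoa_density_nonneg[of p f u]
      by (simp add: ennreal_mult mult_ac)
    finally show "ennreal (bmoa_density p f u) * comp_kernel_integral p (disc_aut u \<circ> \<psi>) a
        \<le> 68 * ennreal (bmoa_density p f u * conf_radius (disc_aut (\<psi> a) u))" .
  qed (use p ennreal_leI[of "p + 2" 4] in auto)
  also have "\<dots> = 272 * bmoa_integral p f (\<psi> a)"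
    by (simp add: bmoa_integral_eq nn_integral_cmult mult.assoc[symmetric])
  finally show ?thesis .
qed

section \<open>Behaviour at the boundary\<close>

lemma tendsto_norm_at_left_1_sequentiallyI:
  fixes I :: "'a::real_normed_algebra_1 \<Rightarrow> 'b::topological_space"
  assumes seq: "\<And>a. (\<And>n. norm (a n) < 1) \<Longrightarrow> (\<lambda>n. norm (a n)) \<longlonglongrightarrow> 1 \<Longrightarrow> (\<lambda>n. I (a n)) \<longlonglongrightarrow> L"
  shows "(I \<longlongrightarrow> L) (filtercomap norm (at_left 1))"
proof (rule topological_tendstoI)
  fix S assume S: "open S" "L \<in> S"
  have "eventually (\<lambda>r. \<forall>z::'a. norm z = r \<longrightarrow> I z \<in> S) (at_left 1)"
  proof (rule sequentially_imp_eventually_at_left)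
    fix r :: "nat \<Rightarrow> real"
    assume r: "\<And>n. 0 < r n" "\<And>n. r n < 1" "r \<longlonglongrightarrow> 1"
    define a :: "nat \<Rightarrow> 'a"
      where "a = (\<lambda>n. if \<exists>z. norm z = r n \<and> I z \<notin> S then SOME z. norm z = r n \<and> I z \<notin> S
        else of_real (r n))"
    have a: "norm (a n) = r n \<and> ((\<exists>z. norm z = r n \<and> I z \<notin> S) \<longrightarrow> I (a n) \<notin> S)" for n
      using someI_ex[of "\<lambda>z. norm z = r n \<and> I z \<notin> S"] r(1)[of n] by (auto simp: a_def)
    then have "(\<lambda>n. I (a n)) \<longlonglongrightarrow> L"
      using r by (intro seq) auto
    then have "eventually (\<lambda>n. I (a n) \<in> S) sequentially"
      using S by (rule topological_tendstoD)
    then show "eventually (\<lambda>n. \<forall>z. norm z = r n \<longrightarrow> I z \<in> S) sequentially"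
      by (rule eventually_mono) (use a in blast)
  qed simp
  then show "eventually (\<lambda>z. I z \<in> S) (filtercomap norm (at_left 1))"
    unfolding eventually_filtercomap by blast
qed

lemma norm_deriv_disc_aut_tendsto_0:
  assumes a: "\<And>n. norm (a n) < 1" "(\<lambda>n. norm (a n)) \<longlonglongrightarrow> 1" and z: "norm z < 1"
  shows "(\<lambda>n. norm (deriv (disc_aut (a n)) z)) \<longlonglongrightarrow> 0"
proof (rule tendsto_sandwich[where f = "\<lambda>_. 0"])
  show "eventually (\<lambda>n. norm (deriv (disc_aut (a n)) z)
      \<le> conf_radius (a n) / (1 - norm z)\<^sup>2) sequentially"
  proof (intro always_eventually allI)
    fix n
    have "1 - norm z \<le> norm (1 - cnj (a n) * z)"
      using norm_disc_aut_denom_ge[of "a n" z] mult_left_le_one_le[of "norm z" "norm (a n)"]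
        a(1)[of n] by simp
    then have "(1 - norm z)\<^sup>2 \<le> (norm (1 - cnj (a n) * z))\<^sup>2"
      using z by (intro power_mono) auto
    then show "norm (deriv (disc_aut (a n)) z) \<le> conf_radius (a n) / (1 - norm z)\<^sup>2"
      unfolding norm_deriv_disc_aut[OF a(1) z]
      using z conf_radius_nonneg[OF a(1)[of n]] disc_aut_denom_nonzero[OF a(1) z, of n]
      by (intro divide_left_mono mult_pos_pos) auto
  qed
  have "(\<lambda>n. (1 - (norm (a n))\<^sup>2) / (1 - norm z)\<^sup>2) \<longlonglongrightarrow> (1 - 1\<^sup>2) / (1 - norm z)\<^sup>2"
    using a(2) z by (intro tendsto_intros) auto
  then show "(\<lambda>n. conf_radius (a n) / (1 - norm z)\<^sup>2) \<longlonglongrightarrow> 0"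
    by (simp add: conf_radius_def)
qed simp_all

lemma powr_mult_powr_le_min:
  fixes x y p \<eta> :: real
  assumes x: "0 \<le> x" and y: "0 \<le> y" and p: "1 \<le> p" "p \<le> 2" and \<eta>: "0 < \<eta>" "\<eta> \<le> 1"
  shows "x powr p * y powr (2 - p) \<le> \<eta> * y\<^sup>2 + min (x powr p * y powr (2 - p)) (x\<^sup>2 / \<eta>)"
proof (cases "x \<le> \<eta> * y")
  case True
  then have "x powr p * y powr (2 - p) \<le> (\<eta> * y) powr p * y powr (2 - p)"
    using x p by (intro mult_right_mono powr_mono2) auto
  also have "\<dots> = \<eta> powr p * y\<^sup>2"
    using y by (simp add: powr_mult mult.assoc powr_numeral flip: powr_add)
  also have "\<dots> \<le> \<eta> * y\<^sup>2"
    using \<eta> p powr_mono'[of 1 p \<eta>] by (intro mult_right_mono) auto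
  finally have "x powr p * y powr (2 - p) \<le> \<eta> * y\<^sup>2" .
  then show ?thesis
    using x \<eta> by (simp add: add_increasing2)
next
  case False
  then have "x powr p * y powr (2 - p) \<le> x powr p * (x / \<eta>) powr (2 - p)"
    using y \<eta> p by (intro mult_left_mono powr_mono2) (auto simp: field_simps)
  also have "\<dots> = x\<^sup>2 / \<eta> powr (2 - p)"
    using x by (simp add: powr_divide powr_numeral flip: powr_add)
  also have "\<dots> \<le> x\<^sup>2 / \<eta>"
    using \<eta> p powr_mono'[of "2 - p" 1 \<eta>] by (intro divide_left_mono) auto
  finally show ?thesis
    using \<eta> by simp
qed

lemma bmoa_density_mult_conf_radius_le:
  assumes a: "norm a < 1" and z: "norm z < 1" and p: "1 \<le> p"
  shows "bmoa_density p H z * conf_radius (disc_aut a z)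
    \<le> norm (deriv H z) powr p * norm (deriv (disc_aut a) z) powr (2 - p)"
proof -
  have "bmoa_density p H z * conf_radius (disc_aut a z)
      = norm (deriv H z) powr p
        * (conf_radius (disc_aut a z) powr (p - 1) * norm (deriv (disc_aut a) z) powr (2 - p))"
    by (simp add: bmoa_density_def mult.assoc conf_radius_powr_mult_disc_aut[OF a z])
  also have "\<dots> \<le> norm (deriv H z) powr p * (1 * norm (deriv (disc_aut a) z) powr (2 - p))"
    using p conf_radius_disc_aut_pos[OF a z] conf_radius_le_one
    by (intro mult_left_mono mult_right_mono powr_le1) auto
  finally show ?thesis
    by simp
qed

text \<open>The cap is an integrable majorant that does not depend on \<open>a\<close>.\<close>

definition capped_density ::
    "real \<Rightarrow> real \<Rightarrow> (complex \<Rightarrow> complex) \<Rightarrow> complex \<Rightarrow> complex \<Rightarrow> real" where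
  "capped_density p \<eta> H a z =
    min (norm (deriv H z) powr p * norm (deriv (disc_aut a) z) powr (2 - p))
      ((norm (deriv H z))\<^sup>2 / \<eta>)"

lemma capped_density_nonneg: "0 \<le> \<eta> \<Longrightarrow> 0 \<le> capped_density p \<eta> H a z"
  by (simp add: capped_density_def)

lemma borel_measurable_capped_density:
  assumes "disc_self_map H" "norm a < 1"
  shows "capped_density p \<eta> H a \<in> borel_measurable disc_measure"
proof -
  note [measurable] = borel_measurable_disc_self_map[OF assms(1)]
    borel_measurable_disc_self_map[OF disc_self_map_disc_aut[OF assms(2)]]
  show ?thesis
    unfolding capped_density_def by measurable
qed

lemma univalent_bmoa_integral_le:
  assumes H: "univalent_self_map H" and a: "norm a < 1" and p: "1 \<le> p" "p \<le> 2"
    and \<eta>: "0 < \<eta>" "\<eta> \<le> 1"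
  shows "bmoa_integral p H a
    \<le> ennreal \<eta> + (\<integral>\<^sup>+z. ennreal (capped_density p \<eta> H a z) \<partial>disc_measure)"
proof -
  define y where "y = (\<lambda>z. norm (deriv (disc_aut a) z))"
  define m where "m = capped_density p \<eta> H a"
  note [measurable] = borel_measurable_disc_self_map[OF disc_self_map_disc_aut[OF a]]
  have [measurable]: "m \<in> borel_measurable disc_measure" "y \<in> borel_measurable disc_measure"
    unfolding m_def y_def using univalent_self_mapD(1)[OF H] a
    by (simp_all add: borel_measurable_capped_density)
  have "bmoa_integral p H a
      \<le> (\<integral>\<^sup>+z. ennreal \<eta> * ennreal ((y z)\<^sup>2) + ennreal (m z) \<partial>disc_measure)"
    unfolding bmoa_integral_eq
  proof (rule nn_integral_mono)
    fix z assume "z \<in> space disc_measure"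
    then have "bmoa_density p H z * conf_radius (disc_aut a z)
        \<le> norm (deriv H z) powr p * y z powr (2 - p)"
      unfolding y_def using a p by (intro bmoa_density_mult_conf_radius_le) auto
    also have "\<dots> \<le> \<eta> * (y z)\<^sup>2 + m z"
      unfolding m_def capped_density_def y_def using p \<eta> by (intro powr_mult_powr_le_min) auto
    finally show "ennreal (bmoa_density p H z * conf_radius (disc_aut a z))
        \<le> ennreal \<eta> * ennreal ((y z)\<^sup>2) + ennreal (m z)"
      using \<eta> by (simp add: ennreal_leI m_def capped_density_nonneg flip: ennreal_mult ennreal_plus)
  qed
  also have "\<dots> = ennreal \<eta> * (\<integral>\<^sup>+z. ennreal ((y z)\<^sup>2) \<partial>disc_measure)
      + (\<integral>\<^sup>+z. ennreal (m z) \<partial>disc_measure)"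
    by (simp add: nn_integral_add nn_integral_cmult)
  also have "\<dots> \<le> ennreal \<eta> * 1 + (\<integral>\<^sup>+z. ennreal (m z) \<partial>disc_measure)"
    unfolding y_def using nn_integral_norm_deriv_sq_le[OF univalent_self_map_disc_aut[OF a]]
    by (intro add_right_mono mult_left_mono) auto
  finally show ?thesis
    by (simp add: m_def)
qed

lemma nn_integral_capped_density_tendsto_0:
  assumes H: "univalent_self_map H" and p: "p < 2" and \<eta>: "0 < \<eta>"
    and a: "\<And>n. norm (a n) < 1" "(\<lambda>n. norm (a n)) \<longlonglongrightarrow> 1"
  shows "(\<lambda>n. \<integral>\<^sup>+z. ennreal (capped_density p \<eta> H (a n) z) \<partial>disc_measure) \<longlonglongrightarrow> 0"
proof -
  define w where "w = (\<lambda>z. ennreal (1 / \<eta>) * ennreal ((norm (deriv H z))\<^sup>2))"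
  note self = univalent_self_mapD(1)[OF H]
  note [measurable] = borel_measurable_disc_self_map[OF self]
    borel_measurable_capped_density[OF self a(1)]
  have "(\<lambda>n. \<integral>\<^sup>+z. ennreal (capped_density p \<eta> H (a n) z) \<partial>disc_measure)
      \<longlonglongrightarrow> (\<integral>\<^sup>+z. 0 \<partial>disc_measure)"
  proof (rule nn_integral_dominated_convergence[where w = w])
    have "(\<integral>\<^sup>+z. w z \<partial>disc_measure) \<le> ennreal (1 / \<eta>) * 1"
      unfolding w_def using mult_left_mono[OF nn_integral_norm_deriv_sq_le[OF H]]
      by (subst nn_integral_cmult) auto
    then show "(\<integral>\<^sup>+z. w z \<partial>disc_measure) < \<infinity>"
      by (rule le_less_trans) simp
    show "AE z in disc_measure. (\<lambda>n. ennreal (capped_density p \<eta> H (a n) z)) \<longlonglongrightarrow> 0"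
    proof (rule AE_I2)
      fix z assume "z \<in> space disc_measure"
      then have "(\<lambda>n. norm (deriv (disc_aut (a n)) z)) \<longlonglongrightarrow> 0"
        using a by (intro norm_deriv_disc_aut_tendsto_0) auto
      then have "(\<lambda>n. norm (deriv (disc_aut (a n)) z) powr (2 - p)) \<longlonglongrightarrow> 0"
        using p by (intro tendsto_zero_powrI[OF _ tendsto_const]) auto
      then have "(\<lambda>n. capped_density p \<eta> H (a n) z)
          \<longlonglongrightarrow> min (norm (deriv H z) powr p * 0) ((norm (deriv H z))\<^sup>2 / \<eta>)"
        unfolding capped_density_def by (intro tendsto_intros)
      then show "(\<lambda>n. ennreal (capped_density p \<eta> H (a n) z)) \<longlonglongrightarrow> 0"
        using \<eta> by (subst ennreal_tendsto_0_iff) (auto simp: capped_density_nonneg)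
    qed
    show "AE z in disc_measure. ennreal (capped_density p \<eta> H (a n) z) \<le> w z" for n
      using \<eta> by (intro AE_I2) (simp add: w_def capped_density_def ennreal_leI flip: ennreal_mult)
  qed (simp_all add: w_def)
  then show ?thesis
    by simp
qed

lemma univalent_bmoa_integral_tendsto_0:
  assumes H: "univalent_self_map H" and p: "1 \<le> p" "p < 2"
    and a: "\<And>n. norm (a n) < 1" "(\<lambda>n. norm (a n)) \<longlonglongrightarrow> 1"
  shows "(\<lambda>n. bmoa_integral p H (a n)) \<longlonglongrightarrow> 0"
proof (rule tendsto_zero_ennreal)
  fix e :: real assume e: "0 < e"
  define \<eta> where "\<eta> = min 1 (e / 2)"
  have \<eta>: "0 < \<eta>" "\<eta> \<le> 1" "\<eta> \<le> e / 2"
    using e by (auto simp: \<eta>_def)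
  have "eventually (\<lambda>n. (\<integral>\<^sup>+z. ennreal (capped_density p \<eta> H (a n) z) \<partial>disc_measure)
      < ennreal (e / 2)) sequentially"
    using nn_integral_capped_density_tendsto_0[OF H p(2) \<eta>(1) a] e
    by (intro order_tendstoD(2)) auto
  then show "eventually (\<lambda>n. bmoa_integral p H (a n) < ennreal e) sequentially"
  proof eventually_elim
    case (elim n)
    have "bmoa_integral p H (a n)
        \<le> ennreal \<eta> + (\<integral>\<^sup>+z. ennreal (capped_density p \<eta> H (a n) z) \<partial>disc_measure)"
      using p by (intro univalent_bmoa_integral_le[OF H a(1) _ _ \<eta>(1,2)]) auto
    also have "\<dots> < ennreal \<eta> + ennreal (e / 2)"
      using elim by (simp add: ennreal_add_left_cancel_less)
    also have "\<dots> \<le> ennreal e"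
      using \<eta> e by (simp add: ennreal_leI flip: ennreal_plus)
    finally show ?case .
  qed
qed

lemma comp_kernel_le_bmoa_density:
  assumes H: "disc_self_map H" and a: "norm a < 1" and z: "norm z < 1" and p: "p \<le> 3"
  shows "comp_kernel p H a z \<le> bmoa_density p H z * conf_radius (disc_aut a z)"
proof -
  define h where "h = conf_radius (H z)"
  have h_bounds: "0 < h" "h \<le> 1"
    using conf_radius_pos[OF disc_self_map_norm_less_one[OF H z]] conf_radius_le_one
    by (simp_all add: h_def)
  have "comp_kernel p H a z
      = bmoa_density p H z * conf_radius (disc_aut a z) * (h ^ 3 / h powr p)"
    by (simp add: comp_kernel_def bmoa_density_def hyp_deriv_def powr_divide flip: h_def)
  also have "h ^ 3 / h powr p = h powr (3 - p)"
    using h_bounds by (simp add: powr_diff powr_numeral)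
  also have "bmoa_density p H z * conf_radius (disc_aut a z) * h powr (3 - p)
      \<le> bmoa_density p H z * conf_radius (disc_aut a z) * 1"
    using h_bounds p conf_radius_disc_aut_pos[OF a z] bmoa_density_nonneg
    by (intro mult_left_mono powr_le1) auto
  finally show ?thesis
    by simp
qed

lemma comp_kernel_integral_tendsto_0:
  assumes H: "univalent_self_map H" and p: "1 \<le> p" "p < 2"
    and a: "\<And>n. norm (a n) < 1" "(\<lambda>n. norm (a n)) \<longlonglongrightarrow> 1"
  shows "(\<lambda>n. comp_kernel_integral p H (a n)) \<longlonglongrightarrow> 0"
proof (rule tendsto_sandwich[OF _ _ tendsto_const univalent_bmoa_integral_tendsto_0[OF assms]])
  show "eventually (\<lambda>n. comp_kernel_integral p H (a n) \<le> bmoa_integral p H (a n)) sequentially"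
    unfolding bmoa_integral_eq comp_kernel_integral_def
    using univalent_self_mapD(1)[OF H] a(1) p
    by (intro always_eventually allI nn_integral_mono ennreal_leI comp_kernel_le_bmoa_density) auto
qed simp

lemma bmoa_integral_le_bmoa_sup: "norm a < 1 \<Longrightarrow> bmoa_integral p f a \<le> bmoa_sup p f"
  unfolding bmoa_sup_def by (rule SUP_upper) simp

lemma comp_kernel_integral_disc_aut_comp_le:
  assumes \<psi>: "univalent_self_map \<psi>" and u: "norm u < 1" and a: "norm a < 1"
    and p: "1 \<le> p" "p \<le> 2" and \<rho>: "norm (\<psi> a) \<le> \<rho>" "\<rho> < 1"
  shows "comp_kernel_integral p (disc_aut u \<circ> \<psi>) a
    \<le> ennreal (272 / (1 - \<rho>\<^sup>2)) * ennreal (conf_radius u)"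
proof -
  have "0 \<le> \<rho>"
    using \<rho>(1) norm_ge_zero order_trans by blast
  then have denom_pos: "0 < 1 - \<rho>\<^sup>2"
    using \<rho>(2) by (simp add: abs_square_less_1)
  have denom_le: "1 - \<rho>\<^sup>2 \<le> conf_radius (\<psi> a)"
    using \<rho>(1) by (simp add: conf_radius_def power_mono)
  have "conf_radius (disc_aut u (\<psi> a)) \<le> 4 * conf_radius u / conf_radius (\<psi> a)"
    using u \<rho> by (intro conf_radius_disc_aut_le) auto
  also have "\<dots> \<le> 4 * conf_radius u / (1 - \<rho>\<^sup>2)"
    using denom_le denom_pos conf_radius_nonneg[OF u] by (intro divide_left_mono mult_pos_pos) auto
  finally have "ennreal (68 * conf_radius ((disc_aut u \<circ> \<psi>) a))
      \<le> ennreal (272 / (1 - \<rho>\<^sup>2) * conf_radius u)"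
    by (intro ennreal_leI) simp
  also have "\<dots> = ennreal (272 / (1 - \<rho>\<^sup>2)) * ennreal (conf_radius u)"
    using conf_radius_nonneg[OF u] by (rule ennreal_mult'')
  finally have "ennreal (68 * conf_radius ((disc_aut u \<circ> \<psi>) a))
      \<le> ennreal (272 / (1 - \<rho>\<^sup>2)) * ennreal (conf_radius u)" .
  with comp_kernel_integral_le[OF univalent_self_map_disc_aut_comp[OF u \<psi>] a p]
  show ?thesis
    by (rule order_trans)
qed

lemma nn_integral_mult_comp_kernel_integral_tendsto_0:
  assumes \<psi>: "univalent_self_map \<psi>" and p: "1 \<le> p" "p < 2"
    and a: "\<And>n. norm (a n) < 1" "(\<lambda>n. norm (a n)) \<longlonglongrightarrow> 1" and \<rho>: "\<rho> < 1"
    and d [measurable]: "d \<in> borel_measurable disc_measure"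
    and fin: "(\<integral>\<^sup>+u. ennreal (d u) * ennreal (conf_radius u) \<partial>disc_measure) < \<infinity>"
  shows "(\<lambda>n. \<integral>\<^sup>+u. (if norm (\<psi> (a n)) \<le> \<rho>
    then ennreal (d u) * comp_kernel_integral p (disc_aut u \<circ> \<psi>) (a n) else 0) \<partial>disc_measure) \<longlonglongrightarrow> 0"
    (is "(\<lambda>n. \<integral>\<^sup>+u. ?g n u \<partial>_) \<longlonglongrightarrow> 0")
proof -
  define w where
    "w = (\<lambda>u. ennreal (272 / (1 - \<rho>\<^sup>2)) * (ennreal (d u) * ennreal (conf_radius u)))"
  note [measurable] =
    borel_measurable_comp_kernel_integral_disc_aut_comp[OF univalent_self_mapD(1)[OF \<psi>]]
  have "(\<lambda>n. \<integral>\<^sup>+u. ?g n u \<partial>disc_measure) \<longlonglongrightarrow> (\<integral>\<^sup>+u. 0 \<partial>disc_measure)"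
  proof (rule nn_integral_dominated_convergence[where w = w])
    show "?g n \<in> borel_measurable disc_measure" "w \<in> borel_measurable disc_measure" for n
      unfolding w_def by measurable
    show "(\<integral>\<^sup>+u. w u \<partial>disc_measure) < \<infinity>"
      using fin by (simp add: w_def nn_integral_cmult ennreal_mult_less_top)
    show "AE u in disc_measure. ?g n u \<le> w u" for n
    proof (rule AE_I2)
      fix u assume "u \<in> space disc_measure"
      then have u: "norm u < 1" by simp
      have "?g n u \<le> ennreal (d u) * (ennreal (272 / (1 - \<rho>\<^sup>2)) * ennreal (conf_radius u))"
        using p \<rho>
        by (auto intro!: mult_left_mono comp_kernel_integral_disc_aut_comp_le[OF \<psi> u a(1)])
      then show "?g n u \<le> w u"
        by (simp only: w_def mult.left_commute)
    qed
    show "AE u in disc_measure. (\<lambda>n. ?g n u) \<longlonglongrightarrow> 0"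
    proof (rule AE_I2, rule tendsto_sandwich[OF _ _ tendsto_const])
      fix u assume "u \<in> space disc_measure"
      then have "univalent_self_map (disc_aut u \<circ> \<psi>)"
        using \<psi> by (simp add: univalent_self_map_disc_aut_comp)
      then have "(\<lambda>n. comp_kernel_integral p (disc_aut u \<circ> \<psi>) (a n)) \<longlonglongrightarrow> 0"
        using p a by (rule comp_kernel_integral_tendsto_0)
      then show "(\<lambda>n. ennreal (d u) * comp_kernel_integral p (disc_aut u \<circ> \<psi>) (a n)) \<longlonglongrightarrow> 0"
        using ennreal_tendsto_cmult[of "ennreal (d u)" _ 0] by simp
    qed auto
  qed simp
  then show ?thesis
    by simp
qed

lemma bmoa_integral_comp_tendsto_0_interior:
  assumes f: "f \<in> BMOA p" and \<psi>: "univalent_self_map \<psi>" and p: "1 \<le> p" "p < 2"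
    and a: "\<And>n. norm (a n) < 1" "(\<lambda>n. norm (a n)) \<longlonglongrightarrow> 1" and \<rho>: "\<rho> < 1"
  shows "(\<lambda>n. if norm (\<psi> (a n)) \<le> \<rho> then bmoa_integral p (f \<circ> \<psi>) (a n) else 0) \<longlonglongrightarrow> 0"
proof -
  define g where "g = (\<lambda>n u. if norm (\<psi> (a n)) \<le> \<rho>
    then ennreal (bmoa_density p f u) * comp_kernel_integral p (disc_aut u \<circ> \<psi>) (a n) else 0)"
  have fh: "f holomorphic_on unit_disc" and fin: "bmoa_sup p f < \<infinity>"
    using f by (auto simp: BMOA_def)
  have "(\<integral>\<^sup>+u. ennreal (bmoa_density p f u) * ennreal (conf_radius u) \<partial>disc_measure)
      = bmoa_integral p f 0"
    unfolding bmoa_integral_eq disc_aut_zero_left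
    by (intro nn_integral_cong) (simp add: ennreal_mult'' conf_radius_nonneg)
  also have "\<dots> < \<infinity>"
    using bmoa_integral_le_bmoa_sup[of 0 p f] fin by (simp add: le_less_trans)
  finally have "(\<lambda>n. \<integral>\<^sup>+u. g n u \<partial>disc_measure) \<longlonglongrightarrow> 0"
    unfolding g_def using borel_measurable_bmoa_density[OF fh]
    by (intro nn_integral_mult_comp_kernel_integral_tendsto_0[OF \<psi> p a \<rho>])
  then have limit: "(\<lambda>n. ennreal (p + 2) * (\<integral>\<^sup>+u. g n u \<partial>disc_measure)) \<longlonglongrightarrow> 0"
    using ennreal_tendsto_cmult[of "ennreal (p + 2)" _ 0] by simp
  have le_integral: "(if norm (\<psi> (a n)) \<le> \<rho> then bmoa_integral p (f \<circ> \<psi>) (a n) else 0)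
      \<le> ennreal (p + 2) * (\<integral>\<^sup>+u. g n u \<partial>disc_measure)" for n
    using bmoa_integral_comp_le_comp_kernel_integral[OF fh univalent_self_mapD(1)[OF \<psi>] a(1) p(1)]
    by (simp add: g_def)
  show ?thesis
    by (rule tendsto_sandwich[OF _ always_eventually[OF allI[OF le_integral]] tendsto_const limit])
      simp
qed

lemma bmoa_integral_comp_tendsto_0:
  assumes f: "f \<in> VMOA p" and \<psi>: "univalent_self_map \<psi>" and p: "1 \<le> p" "p < 2"
  shows "(bmoa_integral p (f \<circ> \<psi>) \<longlongrightarrow> 0) (filtercomap norm (at_left 1))"
proof (rule tendsto_norm_at_left_1_sequentiallyI, rule tendsto_zero_ennreal)
  fix a :: "nat \<Rightarrow> complex" and e :: real
  assume a: "\<And>n. norm (a n) < 1" "(\<lambda>n. norm (a n)) \<longlonglongrightarrow> 1" and e: "0 < e"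
  have f_BMOA: "f \<in> BMOA p" and "(bmoa_integral p f \<longlongrightarrow> 0) (filtercomap norm (at_left 1))"
    using f by (auto simp: VMOA_def)
  then have "((\<lambda>b. 272 * bmoa_integral p f b) \<longlongrightarrow> 0) (filtercomap norm (at_left 1))"
    using ennreal_tendsto_cmult[of 272 _ 0] by simp
  then have "eventually (\<lambda>b. 272 * bmoa_integral p f b < ennreal e) (filtercomap norm (at_left 1))"
    using e by (intro order_tendstoD(2)) auto
  then obtain \<rho> where \<rho>: "\<rho> < 1"
    "\<And>b. \<rho> < norm b \<Longrightarrow> norm b < 1 \<Longrightarrow> 272 * bmoa_integral p f b < ennreal e"
    unfolding eventually_filtercomap eventually_at_left_field by meson
  have "eventually (\<lambda>n. (if norm (\<psi> (a n)) \<le> \<rho> then bmoa_integral p (f \<circ> \<psi>) (a n) else 0)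
      < ennreal e) sequentially"
    using bmoa_integral_comp_tendsto_0_interior[OF f_BMOA \<psi> p a \<rho>(1)] e
    by (intro order_tendstoD(2)) auto
  then show "eventually (\<lambda>n. bmoa_integral p (f \<circ> \<psi>) (a n) < ennreal e) sequentially"
  proof eventually_elim
    case (elim n)
    show ?case
    proof (cases "norm (\<psi> (a n)) \<le> \<rho>")
      case True
      with elim show ?thesis
        by simp
    next
      case False
      have "bmoa_integral p (f \<circ> \<psi>) (a n) \<le> 272 * bmoa_integral p f (\<psi> (a n))"
        using f_BMOA \<psi> a(1) p by (intro bmoa_integral_comp_le) (auto simp: BMOA_def)
      also have "\<dots> < ennreal e"
        using False disc_self_map_norm_less_one[OF univalent_self_mapD(1)[OF \<psi>] a(1)]
        by (intro \<rho>) auto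
      finally show ?thesis .
    qed
  qed
qed

section \<open>Norm estimates\<close>

definition bmoa_seminorm :: "real \<Rightarrow> (complex \<Rightarrow> complex) \<Rightarrow> real" where
  "bmoa_seminorm p f = enn2real (bmoa_sup p f) powr (1 / p)"

lemma powr_add_le_powr:
  fixes x y p :: real
  assumes "0 \<le> x" "0 \<le> y" "1 \<le> p"
  shows "x powr p + y powr p \<le> (x + y) powr p"
proof -
  have powr_split: "t powr p = t * t powr (p - 1)" if "0 \<le> t" for t :: real
    using that assms powr_mult_base[of t "p - 1"] by simp
  have "x powr p + y powr p \<le> x * (x + y) powr (p - 1) + y * (x + y) powr (p - 1)"
    unfolding powr_split[OF assms(1)] powr_split[OF assms(2)]
    using assms by (intro add_mono mult_left_mono powr_mono2) auto
  also have "\<dots> = (x + y) powr p"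
    using assms by (simp add: powr_split distrib_right)
  finally show ?thesis .
qed

lemma norm_at_zero_le_bmoa_norm: "1 \<le> p \<Longrightarrow> norm (f 0) \<le> bmoa_norm p f"
  using powr_mono2[of "1 / p" "norm (f 0) powr p" "norm (f 0) powr p + enn2real (bmoa_sup p f)"]
  by (simp add: bmoa_norm_def powr_powr)

lemma bmoa_seminorm_le_bmoa_norm: "1 \<le> p \<Longrightarrow> bmoa_seminorm p f \<le> bmoa_norm p f"
  unfolding bmoa_seminorm_def bmoa_norm_def by (intro powr_mono2) auto

lemma bmoa_norm_le_add_seminorm:
  assumes "1 \<le> p"
  shows "bmoa_norm p f \<le> norm (f 0) + bmoa_seminorm p f"
proof -
  have "enn2real (bmoa_sup p f) = bmoa_seminorm p f powr p"
    using assms by (simp add: bmoa_seminorm_def powr_powr)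
  then have "norm (f 0) powr p + enn2real (bmoa_sup p f) \<le> (norm (f 0) + bmoa_seminorm p f) powr p"
    using assms powr_add_le_powr[of "norm (f 0)" "bmoa_seminorm p f" p]
    by (simp add: bmoa_seminorm_def)
  then have "bmoa_norm p f \<le> ((norm (f 0) + bmoa_seminorm p f) powr p) powr (1 / p)"
    unfolding bmoa_norm_def using assms by (intro powr_mono2) auto
  then show ?thesis
    using assms by (simp add: powr_powr bmoa_seminorm_def)
qed

lemma powr_inverse_mult_le:
  fixes c s p :: real
  assumes "1 \<le> c" "0 \<le> s" "1 \<le> p"
  shows "(c * s) powr (1 / p) \<le> c * s powr (1 / p)"
proof -
  have "c powr (1 / p) \<le> c powr 1"
    using assms by (intro powr_mono) auto
  then show ?thesis
    using assms by (simp add: powr_mult mult_right_mono)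
qed

lemma norm_deriv_le_bmoa_seminorm:
  assumes f: "f \<in> BMOA p" and w: "norm w < 1" and p: "1 \<le> p"
  shows "norm (deriv f w) * conf_radius w \<le> (p + 2) * bmoa_seminorm p f"
proof -
  have fh: "f holomorphic_on unit_disc" and fin: "bmoa_sup p f < \<infinity>"
    using f by (auto simp: BMOA_def)
  define x s where "x = norm (deriv f w) * conf_radius w" and "s = enn2real (bmoa_sup p f)"
  have sup_eq: "bmoa_sup p f = ennreal s" "0 \<le> s"
    using fin by (auto simp: s_def)
  have x_nonneg: "0 \<le> x"
    using conf_radius_nonneg[OF w] by (simp add: x_def)
  have "ennreal (x powr p) \<le> ennreal (p + 2)
      * (\<integral>\<^sup>+u. ennreal (bmoa_density p f u * conf_radius (disc_aut w u) ^ 3) \<partial>disc_measure)"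
    unfolding x_def using fh w p by (rule norm_deriv_powr_le_nn_integral_bmoa_density)
  also have "\<dots> \<le> ennreal (p + 2) * bmoa_integral p f w"
    unfolding bmoa_integral_eq
  proof (intro mult_left_mono nn_integral_mono ennreal_leI)
    fix u assume "u \<in> space disc_measure"
    then show "conf_radius (disc_aut w u) ^ 3 \<le> conf_radius (disc_aut w u)"
      using conf_radius_disc_aut_pos[OF w, of u] conf_radius_le_one[of "disc_aut w u"]
        power_decreasing[of 1 3 "conf_radius (disc_aut w u)"] by simp
  qed (simp_all add: bmoa_density_nonneg)
  also have "\<dots> \<le> ennreal (p + 2) * bmoa_sup p f"
    using w by (intro mult_left_mono bmoa_integral_le_bmoa_sup) auto
  also have "\<dots> = ennreal ((p + 2) * s)"
    using sup_eq p by (simp only: ennreal_mult)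
  finally have "x powr p \<le> (p + 2) * s"
    using sup_eq p by (subst (asm) ennreal_le_iff) auto
  then have "(x powr p) powr (1 / p) \<le> ((p + 2) * s) powr (1 / p)"
    using p by (intro powr_mono2) auto
  also have "\<dots> \<le> (p + 2) * s powr (1 / p)"
    using sup_eq p by (intro powr_inverse_mult_le) auto
  finally show ?thesis
    using x_nonneg p by (simp add: powr_powr x_def s_def bmoa_seminorm_def)
qed

lemma has_vector_derivative_radial:
  assumes "f holomorphic_on unit_disc" "norm (of_real t * b) < 1"
  shows "((\<lambda>t. f (of_real t * b)) has_vector_derivative b * deriv f (of_real t * b)) (at t)"
proof -
  have "(f has_field_derivative deriv f (of_real t * b)) (at (of_real t * b))"
    using assms by (auto intro!: holomorphic_derivI)
  moreover have "((\<lambda>t. of_real t * b) has_vector_derivative b) (at t)"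
    by (auto intro!: derivative_eq_intros)
  ultimately show ?thesis
    using field_vector_diff_chain_at[of "\<lambda>t. of_real t * b" b t f "deriv f (of_real t * b)"]
    by (auto simp: comp_def)
qed

lemma has_vector_derivative_artanh_mult:
  fixes t x :: real
  assumes "\<bar>t * x\<bar> < 1"
  shows "((\<lambda>t. artanh (t * x)) has_vector_derivative x / (1 - (t * x)\<^sup>2)) (at t)"
proof -
  have "((\<lambda>t. t * x) has_real_derivative x) (at t)"
    by (auto intro!: derivative_eq_intros)
  from DERIV_chain2[OF artanh_real_has_field_derivative this] assms show ?thesis
    by (simp add: has_real_derivative_iff_has_vector_derivative)
qed

lemma Bloch_growth:
  assumes f: "f holomorphic_on unit_disc"
    and K: "\<And>w. norm w < 1 \<Longrightarrow> norm (deriv f w) * conf_radius w \<le> K" and b: "norm b < 1"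
  shows "norm (f b - f 0) \<le> K * artanh (norm b)"
proof -
  define F where "F = (\<lambda>t. f (of_real t * b))"
  define \<phi> where "\<phi> = (\<lambda>t. K * artanh (t * norm b))"
  have in_disc: "norm (of_real t * b) < 1" if "0 \<le> t" "t \<le> 1" for t
    using that b mult_left_le_one_le[of "norm b" t] by (simp add: norm_mult)
  have F': "(F has_vector_derivative b * deriv f (of_real t * b)) (at t)" if "0 \<le> t" "t \<le> 1" for t
    unfolding F_def using f in_disc[OF that] by (rule has_vector_derivative_radial)
  have \<phi>': "(\<phi> has_vector_derivative K * (norm b / (1 - (t * norm b)\<^sup>2))) (at t)"
    if "0 \<le> t" "t \<le> 1" for t
    unfolding \<phi>_def using in_disc[OF that] that
    by (intro has_vector_derivative_mult_right has_vector_derivative_artanh_mult)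
      (simp add: norm_mult abs_mult)
  have "norm (F 1 - F 0) \<le> \<phi> 1 - \<phi> 0"
  proof (rule differentiable_bound_general)
    show "continuous_on {0..1} F" "continuous_on {0..1} \<phi>"
      using F' \<phi>'
      by (auto intro!: continuous_at_imp_continuous_on has_vector_derivative_continuous)
    fix t :: real assume t: "0 < t" "t < 1"
    define w where "w = of_real t * b"
    have w: "norm w < 1" and conf_radius_w: "conf_radius w = 1 - (t * norm b)\<^sup>2"
      using in_disc[of t] t by (simp_all add: w_def conf_radius_def norm_mult)
    have "norm (deriv f w) \<le> K / conf_radius w"
      using K[OF w] conf_radius_pos[OF w] by (simp add: field_simps)
    from mult_left_mono[OF this norm_ge_zero[of b]]
    show "norm (b * deriv f (of_real t * b)) \<le> K * (norm b / (1 - (t * norm b)\<^sup>2))"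
      unfolding w_def[symmetric] conf_radius_w[symmetric] by (simp add: norm_mult mult_ac)
  qed (use F' \<phi>' in auto)
  then show ?thesis
    by (simp add: F_def \<phi>_def)
qed

lemma bmoa_sup_comp_le:
  assumes f: "f holomorphic_on unit_disc" and \<psi>: "univalent_self_map \<psi>" and p: "1 \<le> p" "p \<le> 2"
  shows "bmoa_sup p (f \<circ> \<psi>) \<le> 272 * bmoa_sup p f"
  unfolding bmoa_sup_def[of p "f \<circ> \<psi>"]
proof (rule SUP_least)
  fix a :: complex assume "a \<in> unit_disc"
  then have a: "norm a < 1" by simp
  have "bmoa_integral p (f \<circ> \<psi>) a \<le> 272 * bmoa_integral p f (\<psi> a)"
    using f \<psi> a p by (rule bmoa_integral_comp_le)
  also have "\<dots> \<le> 272 * bmoa_sup p f"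
    using disc_self_map_norm_less_one[OF univalent_self_mapD(1)[OF \<psi>] a]
    by (intro mult_left_mono bmoa_integral_le_bmoa_sup) auto
  finally show "bmoa_integral p (f \<circ> \<psi>) a \<le> 272 * bmoa_sup p f" .
qed

lemma BMOA_comp:
  assumes f: "f \<in> BMOA p" and \<psi>: "univalent_self_map \<psi>" and p: "1 \<le> p" "p \<le> 2"
  shows "f \<circ> \<psi> \<in> BMOA p"
proof -
  have fh: "f holomorphic_on unit_disc" and "bmoa_sup p f < \<infinity>"
    using f by (auto simp: BMOA_def)
  then have "272 * bmoa_sup p f < \<infinity>"
    by (simp add: ennreal_mult_less_top)
  with bmoa_sup_comp_le[OF fh \<psi> p] have "bmoa_sup p (f \<circ> \<psi>) < \<infinity>"
    by (rule le_less_trans)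
  with holomorphic_on_comp_disc_self_map[OF fh univalent_self_mapD(1)[OF \<psi>]] show ?thesis
    by (simp add: BMOA_def)
qed

lemma VMOA_comp:
  assumes f: "f \<in> VMOA p" and \<psi>: "univalent_self_map \<psi>" and p: "1 \<le> p" "p < 2"
  shows "f \<circ> \<psi> \<in> VMOA p"
  using BMOA_comp[of f p \<psi>] bmoa_integral_comp_tendsto_0[OF assms] assms
  by (simp add: VMOA_def)

lemma bmoa_seminorm_comp_le:
  assumes f: "f \<in> BMOA p" and \<psi>: "univalent_self_map \<psi>" and p: "1 \<le> p" "p \<le> 2"
  shows "bmoa_seminorm p (f \<circ> \<psi>) \<le> 272 * bmoa_seminorm p f"
proof -
  define s where "s = enn2real (bmoa_sup p f)"
  have fh: "f holomorphic_on unit_disc" and sup_eq: "bmoa_sup p f = ennreal s" "0 \<le> s"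
    using f by (auto simp: BMOA_def s_def)
  have "bmoa_sup p (f \<circ> \<psi>) \<le> ennreal (272 * s)"
    using bmoa_sup_comp_le[OF fh \<psi> p] sup_eq by (simp add: ennreal_mult)
  then have "enn2real (bmoa_sup p (f \<circ> \<psi>)) \<le> 272 * s"
    using sup_eq by (intro enn2real_leI) auto
  then have "bmoa_seminorm p (f \<circ> \<psi>) \<le> (272 * s) powr (1 / p)"
    unfolding bmoa_seminorm_def using p by (intro powr_mono2) auto
  also have "\<dots> \<le> 272 * bmoa_seminorm p f"
    unfolding bmoa_seminorm_def s_def using p by (intro powr_inverse_mult_le) auto
  finally show ?thesis .
qed

lemma bmoa_norm_comp_le:
  assumes f: "f \<in> BMOA p" and \<psi>: "univalent_self_map \<psi>" and p: "1 \<le> p" "p \<le> 2"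
  shows "bmoa_norm p (f \<circ> \<psi>) \<le> 273 * (1 + 2 * artanh (norm (\<psi> 0))) * bmoa_norm p f"
proof -
  define N S A where "N = bmoa_norm p f" and "S = bmoa_seminorm p f" and "A = artanh (norm (\<psi> 0))"
  have \<psi>0: "norm (\<psi> 0) < 1"
    using disc_self_map_norm_less_one[OF univalent_self_mapD(1)[OF \<psi>], of 0] by simp
  have A_nonneg: "0 \<le> A"
    unfolding A_def artanh_def using \<psi>0 by (simp add: field_simps)
  have le_N: "norm (f 0) \<le> N" "S \<le> N"
    unfolding N_def S_def using p
    by (simp_all add: norm_at_zero_le_bmoa_norm bmoa_seminorm_le_bmoa_norm)
  have "norm (f (\<psi> 0) - f 0) \<le> ((p + 2) * S) * A"
    unfolding S_def A_def using f \<psi>0 p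
    by (intro Bloch_growth norm_deriv_le_bmoa_seminorm) (auto simp: BMOA_def)
  also have "\<dots> \<le> (4 * N) * A"
    using p le_N A_nonneg by (intro mult_right_mono mult_mono) (auto simp: S_def bmoa_seminorm_def)
  finally have "norm (f (\<psi> 0)) \<le> N + 4 * N * A"
    using le_N norm_triangle_ineq2[of "f (\<psi> 0)" "f 0"] by simp
  moreover have "bmoa_norm p (f \<circ> \<psi>) \<le> norm (f (\<psi> 0)) + 272 * S"
    using bmoa_norm_le_add_seminorm[of p "f \<circ> \<psi>"] bmoa_seminorm_comp_le[OF f \<psi> p] p
    by (simp add: S_def)
  ultimately have "bmoa_norm p (f \<circ> \<psi>) \<le> 273 * N + 4 * (N * A)"
    using le_N by simp
  also have "\<dots> \<le> 273 * N + 546 * (N * A)"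
    using A_nonneg le_N order_trans[OF norm_ge_zero le_N(1)] by simp
  also have "\<dots> = 273 * (1 + 2 * A) * N"
    by (simp add: algebra_simps)
  finally show ?thesis
    by (simp add: A_def N_def)
qed

lemma bounded_operator_composition_operator:
  assumes "\<And>f. f \<in> X \<Longrightarrow> f \<circ> \<psi> \<in> Y" "\<And>f. f \<in> X \<Longrightarrow> N (f \<circ> \<psi>) \<le> K * N f"
  shows "bounded_operator X Y N (composition_operator \<psi>)"
  unfolding bounded_operator_def composition_operator_def
  using assms by (auto simp: fun_eq_iff)

lemma operator_norm_le:
  assumes "0 \<le> K" "\<And>f. f \<in> X \<Longrightarrow> N (T f) \<le> K * N f"
  shows "operator_norm X N T \<le> ennreal K"
  unfolding operator_norm_def
proof (rule SUP_least)
  fix f assume "f \<in> {f \<in> X. N f \<le> 1}"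
  then show "ennreal (N (T f)) \<le> ennreal K"
    using assms(2)[of f] mult_left_mono[of "N f" 1 K] assms(1) by (intro ennreal_leI) auto
qed

theorem theorem1:
  fixes p :: real
  assumes "1 \<le> p" and "p < 2"
  shows "\<exists>C::real. C > 0 \<and>
    (\<forall>\<psi> :: complex \<Rightarrow> complex.
       \<psi> holomorphic_on unit_disc \<and> \<psi> ` unit_disc \<subseteq> unit_disc \<and> inj_on \<psi> unit_disc \<longrightarrow>
         bounded_operator (BMOA p) (BMOA p) (bmoa_norm p) (composition_operator \<psi>) \<and>
         operator_norm (BMOA p) (bmoa_norm p) (composition_operator \<psi>)
           \<le> ennreal (C * (1 + ln ((1 + norm (\<psi> 0)) / (1 - norm (\<psi> 0))))) \<and>
         bounded_operator (VMOA p) (VMOA p) (bmoa_norm p) (composition_operator \<psi>))"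
proof (intro exI[of _ 273] conjI allI impI)
  fix \<psi> :: "complex \<Rightarrow> complex"
  define K where "K = 273 * (1 + ln ((1 + norm (\<psi> 0)) / (1 - norm (\<psi> 0))))"
  assume "\<psi> holomorphic_on unit_disc \<and> \<psi> ` unit_disc \<subseteq> unit_disc \<and> inj_on \<psi> unit_disc"
  then have \<psi>: "univalent_self_map \<psi>"
    by (simp add: univalent_self_map_def disc_self_map_def)
  have bound: "bmoa_norm p (f \<circ> \<psi>) \<le> K * bmoa_norm p f" if "f \<in> BMOA p" for f
    using bmoa_norm_comp_le[OF that \<psi>] assms by (simp add: K_def artanh_def)
  have "norm (\<psi> 0) < 1"
    using disc_self_map_norm_less_one[OF univalent_self_mapD(1)[OF \<psi>], of 0] by simp
  then have "0 \<le> K"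
    by (simp add: K_def field_simps)
  show "bounded_operator (BMOA p) (BMOA p) (bmoa_norm p) (composition_operator \<psi>)"
    using bound BMOA_comp[OF _ \<psi>] assms by (intro bounded_operator_composition_operator) auto
  show "bounded_operator (VMOA p) (VMOA p) (bmoa_norm p) (composition_operator \<psi>)"
    using bound VMOA_comp[OF _ \<psi> assms]
    by (intro bounded_operator_composition_operator) (auto simp: VMOA_def)
  show "operator_norm (BMOA p) (bmoa_norm p) (composition_operator \<psi>)
      \<le> ennreal (273 * (1 + ln ((1 + norm (\<psi> 0)) / (1 - norm (\<psi> 0)))))"
    unfolding K_def[symmetric] using \<open>0 \<le> K\<close> bound
    by (intro operator_norm_le) (auto simp: composition_operator_def)
qed simp

end
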